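(* Let $X_1,X_2,\ldots$ be iid random variables on $[0,1]$ with mean $\mu$ and variance $\sigma^2$. Suppose $\sigma>0$ and fix $\alpha_{\mathrm L},\alpha_{\mathrm U}\in(0,1)$. Let $\mathbf X=(X_1,\dots,X_n)$. Then, almost surely, as $n\to\infty$, $$L_{\alpha_{\mathrm L}}(\mathbf X)=\bar X_n+\frac{\widehat\sigma_n}{\sqrt n}z_{\alpha_{\mathrm L}}+o(n^{-1/2}),\qquad U_{\alpha_{\mathrm U}}(\mathbf X)=\bar X_n+\frac{\widehat\sigma_n}{\sqrt n}z_{1-\alpha_{\mathrm U}}+o(n^{-1/2}).$$ Consequently, $$\sqrt n\,\bigl(U_{\alpha_{\mathrm U}}(\mathbf X)-L_{\alpha_{\mathrm L}}(\mathbf X)\bigr)\longrightarrow\sigma\bigl(z_{1-\alpha_{\mathrm U}}-z_{\alpha_{\mathrm L}}\bigr)\qquad\text{almost surely}.$$ If $\alpha_{\mathrm L}+\alpha_{\mathrm U}<1$, then $$\mathbb P\{L_{\alpha_{\mathrm L}}(\mathbf X)<\mu<U_{\alpha_{\mathrm U}}(\mathbf X)\}\longrightarrow 1-\alpha_{\mathrm L}-\alpha_{\mathrm U}.$$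
   Context: $\bar X_n=\frac1n\sum_{i=1}^nX_i$, $\widehat\sigma_n^2=\frac1n\sum_{i=1}^n(X_i-\bar X_n)^2$ with $\widehat\sigma_n\ge0$, and $z_q=\Phi^{-1}(q)$ with $\Phi$ the standard normal CDF. For $\mathbf x=(x_1,\dots,x_n)\in[0,1]^n$ let $(D_0,D_1,\ldots,D_n)\sim\mathrm{Dirichlet}(1,\ldots,1)$ ($n+1$ coordinates) and $S_{\mathbf x}=\sum_{i=1}^n x_iD_i$, $T_{\mathbf x}=D_0+\sum_{i=1}^n x_iD_i$. For a real random variable $Y$ and $q\in(0,1)$, $Q_q(Y)=\inf\{t:\mathbb P(Y\le t)\ge q\}$. The endpoints of the Gaffke interval are $L_{\alpha_{\mathrm L}}(\mathbf x)=Q_{\alpha_{\mathrm L}}(S_{\mathbf x})$ and $U_{\alpha_{\mathrm U}}(\mathbf x)=Q_{1-\alpha_{\mathrm U}}(T_{\mathbf x})$, the quantiles being taken over the Dirichlet randomness with $\mathbf x$ fixed; $L_{\alpha_{\mathrm L}}(\mathbf X)$ and $U_{\alpha_{\mathrm U}}(\mathbf X)$ denote these functions evaluated at $\mathbf x=\mathbf X$. *)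

theory Defs
  imports "HOL-Probability.Probability"
begin

definition quantile :: "'a measure \<Rightarrow> ('a \<Rightarrow> real) \<Rightarrow> real \<Rightarrow> real" where
  "quantile M Y q = Inf {t. measure M {\<omega> \<in> space M. Y \<omega> \<le> t} \<ge> q}"

definition std_normal_quantile :: "real \<Rightarrow> real" where
  "std_normal_quantile q = inv (cdf std_normal_distribution) q"

text \<open>The density of the Dirichlet distribution with parameters \<open>a 0, \<dots>, a n\<close>, in the coordinates
  \<open>d 1, \<dots>, d n\<close> of the simplex; the coordinate \<open>d 0\<close> is \<open>1 - (\<Sum>i=1..n. d i)\<close>.
  The open simplex is used because \<open>0 powr 0 = 0\<close>.\<close>

definition dirichlet_density :: "nat \<Rightarrow> (nat \<Rightarrow> real) \<Rightarrow> (nat \<Rightarrow> real) \<Rightarrow> real" where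
  "dirichlet_density n a d =
     (if (\<forall>i\<in>{1..n}. 0 < d i) \<and> (\<Sum>i=1..n. d i) < 1
      then Gamma (\<Sum>i=0..n. a i) / (\<Prod>i=0..n. Gamma (a i)) *
           ((1 - (\<Sum>i=1..n. d i)) powr (a 0 - 1) * (\<Prod>i=1..n. d i powr (a i - 1)))
      else 0)"

definition dirichlet :: "nat \<Rightarrow> (nat \<Rightarrow> real) \<Rightarrow> (nat \<Rightarrow> real) measure" where
  "dirichlet n a =
     distr (density (Pi\<^sub>M {1..n} (\<lambda>_. lborel)) (\<lambda>d. ennreal (dirichlet_density n a d)))
       (Pi\<^sub>M {0..n} (\<lambda>_. borel))
       (\<lambda>d. \<lambda>i\<in>{0..n}. if i = 0 then 1 - (\<Sum>j=1..n. d j) else d i)"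

text \<open>A sample \<open>x 1, \<dots>, x n\<close> is represented by a function on \<^typ>\<open>nat\<close> of which only the values
  at \<open>1, \<dots>, n\<close> are used.\<close>

definition gaffke_lower :: "nat \<Rightarrow> real \<Rightarrow> (nat \<Rightarrow> real) \<Rightarrow> real" where
  "gaffke_lower n \<alpha> x = quantile (dirichlet n (\<lambda>_. 1)) (\<lambda>D. \<Sum>i=1..n. x i * D i) \<alpha>"

definition gaffke_upper :: "nat \<Rightarrow> real \<Rightarrow> (nat \<Rightarrow> real) \<Rightarrow> real" where
  "gaffke_upper n \<alpha> x = quantile (dirichlet n (\<lambda>_. 1)) (\<lambda>D. D 0 + (\<Sum>i=1..n. x i * D i)) (1 - \<alpha>)"

definition sample_mean :: "nat \<Rightarrow> (nat \<Rightarrow> real) \<Rightarrow> real" where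
  "sample_mean n x = (\<Sum>i=1..n. x i) / real n"

definition sample_sd :: "nat \<Rightarrow> (nat \<Rightarrow> real) \<Rightarrow> real" where
  "sample_sd n x = sqrt ((\<Sum>i=1..n. (x i - sample_mean n x)\<^sup>2) / real n)"

end

theory Submission
  imports Defs
begin

text \<open>
  Fix a sample with values in \<open>[0, 1]\<close> whose standard deviations converge to some \<open>s > 0\<close>; almost
  every realisation is of this kind, by the strong law for \<open>X\<close> and \<open>X\<^sup>2\<close>. Both endpoints of the interval
  are quantiles of a weighted mean \<open>b D\<^sub>0 + x\<^sub>1 D\<^sub>1 + \<dots> + x\<^sub>n D\<^sub>n\<close>, with \<open>b = 0\<close> for the lower and \<open>b = 1\<close>
  for the upper one, so one conditional central limit theorem covers both.

  The flat Dirichlet vector is a vector of independent standard exponential variables divided by its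
  sum. The event that the weighted mean is at most \<open>t\<close> is the homogeneous condition
  \<open>\<Sum>k. (y k - t) * D k \<le> 0\<close>, whose truth does not change under rescaling; so its probability may be
  computed with the exponential variables themselves (\<open>emeasure_dirichlet_one_cone\<close>), and the random
  normalisation never has to be dealt with. What remains is the law of a linear combination of
  independent exponential variables with deterministic coefficients. Its characteristic function is the
  product of the factors \<open>1 / (1 - \<i> t c)\<close>, each within \<open>\<bar>t c\<bar>\<^sup>3\<close> of \<open>exp (\<i> t c - t\<^sup>2 c\<^sup>2 / 2)\<close>, and
  Levy's theorem gives a normal limit as soon as the sums of the coefficients, of their squares and of
  the cubes of their moduli converge to the right values (\<open>clt_weighted_exponentials\<close>). With
  \<open>t = mean + v / sqrt n\<close> this says that the probability tends to \<open>\<Phi> (v / s)\<close>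
  (\<open>dirichlet_mean_clt\<close>). Inverting the limit, which is continuous and strictly increasing, turns
  this into \<open>sqrt n * (quantile - mean) \<longrightarrow> s * z\<close>, from which the expansions and the width follow.

  For the coverage, put \<open>V = sqrt n * (\<mu> - mean) / \<sigma>\<close>, which is asymptotically standard normal by the
  classical central limit theorem. The event \<open>L < \<mu> < U\<close> says that \<open>V\<close> lies strictly between the
  rescaled endpoints, and these converge almost surely to the two normal quantiles; a Slutsky argument
  gives the limit \<open>(1 - \<alpha>U) - \<alpha>L\<close>.
\<close>

section \<open>The standard exponential law\<close>

definition std_exponential :: "real measure" where
  "std_exponential = density lborel (exponential_density 1)"

text \<open>The support is taken to be the open half-line, so that the simplex obtained below by a shift of
  variables is the open one on which the Dirichlet density lives.\<close>

lemma std_exponential_eq: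
  "std_exponential = density lborel (\<lambda>x. ennreal (exp (- x) * indicator {0<..} x))"
  unfolding std_exponential_def
  using AE_lborel_singleton[of "0::real"]
  by (intro density_cong) (auto simp: exponential_density_def split: split_indicator)

lemma real_distribution_std_exponential: "real_distribution std_exponential"
  unfolding real_distribution_def real_distribution_axioms_def
  using prob_space_exponential_density[of 1]
  by (simp add: std_exponential_def)

lemma char_std_exponential: "char std_exponential t = 1 / (1 - \<i> * t)"
proof -
  let ?c = "\<i> * t - 1"
  let ?f = "\<lambda>x::real. exp (?c * x)"
  have c0: "?c \<noteq> 0"
    by (auto simp: complex_eq_iff)
  \<comment> \<open>The modulus does not depend on the frequency, so the integrand is dominated by the density.\<close>
  have norm_f: "norm (?f x) = exp (- x)" for x
    by simp
  have int: "set_integrable lborel {0<..} ?f"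
    unfolding set_integrable_def
  proof (rule Bochner_Integration.integrable_bound)
    show "integrable lborel (\<lambda>x::real. x^0 * exp (-x) * indicator {0 <..} x)"
      using has_bochner_integral_I0i_power_exp_m[of 0] by (rule integrable.intros)
  qed (auto simp: norm_f split: split_indicator)
  have "char std_exponential t = (CLINT x|lborel. (exp (- x) * indicator {0<..} x) *\<^sub>R iexp (t * x))"
    unfolding char_def std_exponential_eq
    by (subst integral_density) (auto split: split_indicator)
  also have "\<dots> = (CLBINT x:{0<..}. ?f x)"
    unfolding set_lebesgue_integral_def
    by (intro Bochner_Integration.integral_cong)
       (auto simp: exp_of_real[symmetric] scaleR_conv_of_real exp_add[symmetric] algebra_simps split: split_indicator)
  also have "\<dots> = (CLBINT x=0..\<infinity>. ?f x)"
    by (simp add: interval_lebesgue_integral_0_infty)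
  also have "\<dots> = 0 - 1 / ?c"
  proof (rule interval_integral_FTC_integrable[where F = "\<lambda>x. ?f x / ?c"])
    show "((\<lambda>x. ?f x / ?c) has_vector_derivative ?f x) (at x)" for x
      using c0 by (intro has_vector_derivative_real_field) (auto intro!: derivative_eq_intros)
    show "set_integrable lborel (einterval 0 \<infinity>) ?f"
      using int by (simp add: zero_ereal_def)
    show "(((\<lambda>x. ?f x / ?c) \<circ> real_of_ereal) \<longlongrightarrow> 1 / ?c) (at_right 0)"
    proof -
      have "isCont (\<lambda>x. ?f x / ?c) 0"
        using c0 by (intro continuous_intros) auto
      then have "((\<lambda>x. ?f x / ?c) \<longlongrightarrow> ?f 0 / ?c) (at_right 0)"
        unfolding isCont_def by (rule filterlim_at_split[THEN iffD1, THEN conjunct2])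
      then show ?thesis
        unfolding zero_ereal_def ereal_tendsto_simps by simp
    qed
    show "(((\<lambda>x. ?f x / ?c) \<circ> real_of_ereal) \<longlongrightarrow> 0) (at_left \<infinity>)"
      unfolding ereal_tendsto_simps
    proof (rule tendsto_norm_zero_cancel)
      have "((\<lambda>x. exp (- x) / norm ?c) \<longlongrightarrow> 0 / norm ?c) at_top"
        using c0 by (intro tendsto_divide tendsto_const exp_at_bot[THEN filterlim_compose, OF filterlim_uminus_at_bot_at_top]) auto
      then show "((\<lambda>x. norm (?f x / ?c)) \<longlongrightarrow> 0) at_top"
        by (simp add: norm_divide)
    qed
  qed auto
  also have "\<dots> = 1 / (1 - \<i> * t)"
    using c0 by (simp add: field_simps)
  finally show ?thesis .
qed

section \<open>The flat Dirichlet law as a law of normalised exponentials\<close>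

text \<open>The change of variables for a homothety in a product of copies of the real line: both sides agree on
  boxes. A dimension given by a finite index set, rather than by a type, is needed since the
  sample size varies.\<close>

lemma PiM_lborel_scale:
  fixes s :: real
  assumes "finite I" "s > 0"
  shows "Pi\<^sub>M I (\<lambda>_. lborel) = scale_measure (ennreal (s ^ card I))
      (distr (Pi\<^sub>M I (\<lambda>_. lborel)) (Pi\<^sub>M I (\<lambda>_. lborel)) (\<lambda>x. \<lambda>i\<in>I. s * x i))"
    (is "?P = scale_measure ?r ?D")
proof -
  interpret product_sigma_finite "\<lambda>_::'a. lborel :: real measure" ..
  have meas: "(\<lambda>x. \<lambda>i\<in>I. s * x i) \<in> measurable ?P ?P"
    by measurable
  have "scale_measure ?r ?D = ?P"
  proof (rule PiM_eqI)
    fix A :: "'a \<Rightarrow> real set" assume A: "\<And>i. i \<in> I \<Longrightarrow> A i \<in> sets lborel"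
    have vim: "(\<lambda>x. s * x) -` A i \<in> sets lborel" if "i \<in> I" for i
      using measurable_sets[of "\<lambda>x. s * x" borel borel "A i"] A[OF that] by simp
    have one: "emeasure lborel (A i) = ennreal s * emeasure lborel ((\<lambda>x. s * x) -` A i)" if "i \<in> I" for i
    proof -
      have "emeasure lborel (A i)
          = emeasure (density (distr lborel borel (\<lambda>x. 0 + s * x)) (\<lambda>_. ennreal (abs s))) (A i)"
        using \<open>s > 0\<close> by (subst (1) lborel_real_affine[of s 0]) auto
      also have "\<dots> = ennreal s * emeasure lborel ((\<lambda>x. s * x) -` A i)"
        using A[OF that] \<open>s > 0\<close> by (subst emeasure_density) (auto simp: nn_integral_cmult emeasure_distr)
      finally show ?thesis .
    qed
    have pre: "(\<lambda>x. \<lambda>i\<in>I. s * x i) -` (Pi\<^sub>E I A) \<inter> space ?P = Pi\<^sub>E I (\<lambda>i. (\<lambda>x. s * x) -` A i)"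
      by (auto simp: space_PiM PiE_def Pi_def extensional_def)
    have "Pi\<^sub>E I A \<in> sets ?P"
      using A assms(1) by (intro sets_PiM_I_finite) auto
    then have "emeasure (scale_measure ?r ?D) (Pi\<^sub>E I A) = ?r * emeasure ?P (Pi\<^sub>E I (\<lambda>i. (\<lambda>x. s * x) -` A i))"
      using meas by (simp add: emeasure_distr pre)
    also have "\<dots> = (\<Prod>i\<in>I. ennreal s) * (\<Prod>i\<in>I. emeasure lborel ((\<lambda>x. s * x) -` A i))"
      using assms vim by (simp add: emeasure_PiM ennreal_power)
    also have "\<dots> = (\<Prod>i\<in>I. emeasure lborel (A i))"
      by (simp add: prod.distrib one)
    finally show "emeasure (scale_measure ?r ?D) (Pi\<^sub>E I A) = (\<Prod>i\<in>I. emeasure lborel (A i))" .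
  qed (use assms in auto)
  then show ?thesis ..
qed

lemma PiM_density:
  fixes f :: "'b \<Rightarrow> ennreal"
  assumes "finite I" and sf: "sigma_finite_measure N" and sf': "sigma_finite_measure (density N f)"
    and f[measurable]: "f \<in> borel_measurable N"
  shows "Pi\<^sub>M I (\<lambda>_. density N f) = density (Pi\<^sub>M I (\<lambda>_. N)) (\<lambda>x. \<Prod>i\<in>I. f (x i))"
proof -
  interpret N: product_sigma_finite "\<lambda>_::'a. N" unfolding product_sigma_finite_def using sf by simp
  interpret D: product_sigma_finite "\<lambda>_::'a. density N f" unfolding product_sigma_finite_def using sf' by simp
  have [measurable]: "(\<lambda>x. \<Prod>i\<in>I. f (x i)) \<in> borel_measurable (Pi\<^sub>M I (\<lambda>_. N))"
    by measurable
  show ?thesis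
  proof (rule D.PiM_eqI[symmetric])
    show "sets (density (Pi\<^sub>M I (\<lambda>_. N)) (\<lambda>x. \<Prod>i\<in>I. f (x i))) = sets (Pi\<^sub>M I (\<lambda>_. density N f))"
      by (auto intro!: sets_PiM_cong)
    fix A assume A: "\<And>i. i \<in> I \<Longrightarrow> A i \<in> sets (density N f)"
    have "Pi\<^sub>E I A \<in> sets (Pi\<^sub>M I (\<lambda>_. N))"
      using A assms(1) by (intro sets_PiM_I_finite) auto
    then have "emeasure (density (Pi\<^sub>M I (\<lambda>_. N)) (\<lambda>x. \<Prod>i\<in>I. f (x i))) (Pi\<^sub>E I A)
        = (\<integral>\<^sup>+x. (\<Prod>i\<in>I. f (x i)) * indicator (Pi\<^sub>E I A) x \<partial>Pi\<^sub>M I (\<lambda>_. N))"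
      by (simp add: emeasure_density)
    also have "\<dots> = (\<integral>\<^sup>+x. (\<Prod>i\<in>I. f (x i) * indicator (A i) (x i)) \<partial>Pi\<^sub>M I (\<lambda>_. N))"
    proof (intro nn_integral_cong)
      fix x assume "x \<in> space (Pi\<^sub>M I (\<lambda>_. N))"
      then have "indicator (Pi\<^sub>E I A) x = (\<Prod>i\<in>I. indicator (A i) (x i) :: ennreal)"
        using assms(1) by (auto simp: indicator_def space_PiM PiE_def Pi_def)
      then show "(\<Prod>i\<in>I. f (x i)) * indicator (Pi\<^sub>E I A) x = (\<Prod>i\<in>I. f (x i) * indicator (A i) (x i))"
        by (simp add: prod.distrib)
    qed
    also have "\<dots> = (\<Prod>i\<in>I. emeasure (density N f) (A i))"
      using A assms(1) by (subst N.product_nn_integral_prod) (auto simp: emeasure_density intro!: prod.cong)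
    finally show "emeasure (density (Pi\<^sub>M I (\<lambda>_. N)) (\<lambda>x. \<Prod>i\<in>I. f (x i))) (Pi\<^sub>E I A)
        = (\<Prod>i\<in>I. emeasure (density N f) (A i))" .
  qed fact
qed

lemma dirichlet_density_one:
  "dirichlet_density n (\<lambda>_. 1) d =
     fact n * indicator {d. (\<forall>i\<in>{1..n}. 0 < d i) \<and> (\<Sum>i=1..n. d i) < 1} d"
  using Gamma_fact[of n, where ?'a = real]
  by (auto simp: dirichlet_density_def add.commute intro!: prod.neutral)

lemma simplex_coordinates_measurable:
  fixes n :: nat
  shows "(\<lambda>d. \<lambda>i\<in>{0..n}. if i = 0 then 1 - (\<Sum>j=1..n. d j) else d i :: real)
    \<in> measurable (Pi\<^sub>M {1..n} (\<lambda>_. lborel)) (Pi\<^sub>M {0..n} (\<lambda>_. borel))"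
proof (rule measurable_restrict)
  fix i assume "i \<in> {0..n}"
  then have "i = 0 \<or> i \<in> {1..n}" by auto
  then show "(\<lambda>d. if i = 0 then 1 - (\<Sum>j=1..n. d j) else d i)
      \<in> borel_measurable (Pi\<^sub>M {1..n} (\<lambda>_. lborel))"
    by (elim disjE) auto
qed

text \<open>For a vector of \<open>n + 1\<close> standard exponential variables, replace the coordinate \<open>0\<close> by the sum
  \<open>s\<close> of all coordinates. The joint density becomes \<open>exp (- s)\<close> on the set where the other coordinates
  are positive with sum below \<open>s\<close>, hence is constant given \<open>s\<close>. The part of the simplex of
  size \<open>s\<close> inside the half-space is \<open>s\<close> times the corresponding part of the unit simplex, because the
  condition is homogeneous. Its volume is therefore proportional to \<open>s ^ n\<close>, and the integral of
  \<open>s ^ n * exp (- s)\<close> is exactly the constant \<open>n!\<close> of the Dirichlet density.\<close>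

lemma emeasure_dirichlet_one_cone:
  "emeasure (dirichlet n (\<lambda>_. 1))
      {D \<in> space (dirichlet n (\<lambda>_. 1)). (\<Sum>k=0..n. c k * D k) \<le> 0}
   = emeasure (Pi\<^sub>M {0..n} (\<lambda>_. std_exponential))
      {E \<in> space (Pi\<^sub>M {0..n} (\<lambda>_. std_exponential)). (\<Sum>k=0..n. c k * E k) \<le> 0}"
  (is "?dir = ?exp")
proof -
  note One_nat_def[simp del]
  let ?P = "Pi\<^sub>M {1..n} (\<lambda>_. lborel) :: (nat \<Rightarrow> real) measure"
  let ?Pins = "Pi\<^sub>M (insert 0 {1..n}) (\<lambda>_. lborel) :: (nat \<Rightarrow> real) measure"
  interpret L: product_sigma_finite "\<lambda>_::nat. lborel :: real measure" ..
  interpret P: finite_product_sigma_finite "\<lambda>_::nat. lborel :: real measure" "{1..n}"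
    by standard auto
  interpret PL: pair_sigma_finite ?P "lborel :: real measure" ..
  interpret E: real_distribution std_exponential
    by (rule real_distribution_std_exponential)
  \<comment> \<open>the slice of the cone at total mass \<open>s\<close>, in the coordinates \<open>1, \<dots>, n\<close>\<close>
  define K :: "real \<Rightarrow> (nat \<Rightarrow> real) \<Rightarrow> ennreal" where
    "K s x = (if (\<forall>i\<in>{1..n}. 0 < x i) \<and> (\<Sum>i=1..n. x i) < s \<and>
       c 0 * (s - (\<Sum>i=1..n. x i)) + (\<Sum>i=1..n. c i * x i) \<le> 0 then 1 else 0)" for s x
  have K_meas: "(\<lambda>(x, s). K s x) \<in> borel_measurable (?P \<Otimes>\<^sub>M lborel)"
    unfolding K_def by measurable
  have K_meas1: "K s \<in> borel_measurable ?P" for s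
    unfolding K_def by measurable
  have K_meas2: "(\<lambda>s. K s x) \<in> borel_measurable borel" for x
    unfolding K_def by measurable
  let ?V = "\<integral>\<^sup>+x. K 1 x \<partial>?P"
  have scale: "(\<integral>\<^sup>+x. K s x \<partial>?P) = ennreal (s ^ n) * ?V" if "s > 0" for s
  proof -
    have "(\<integral>\<^sup>+x. K s x \<partial>?P)
        = (\<integral>\<^sup>+x. K s x \<partial>scale_measure (ennreal (s ^ card {1..n}))
             (distr ?P ?P (\<lambda>x. \<lambda>i\<in>{1..n}. s * x i)))"
      using PiM_lborel_scale[of "{1..n}" s] that by simp
    also have "\<dots> = ennreal (s ^ n) * (\<integral>\<^sup>+x. K s (\<lambda>i\<in>{1..n}. s * x i) \<partial>?P)"
    proof -
      have "(\<lambda>x. \<lambda>i\<in>{1..n}. s * x i) \<in> measurable ?P ?P"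
        by measurable
      then show ?thesis
        using K_meas1[of s] by (simp add: nn_integral_scale_measure nn_integral_distr)
    qed
    also have "(\<lambda>x. K s (\<lambda>i\<in>{1..n}. s * x i)) = K 1"
    proof
      fix x :: "nat \<Rightarrow> real"
      have 1: "(\<Sum>i=1..n. (\<lambda>i\<in>{1..n}. s * x i) i) = s * (\<Sum>i=1..n. x i)"
        by (simp add: sum_distrib_left)
      have 2: "c 0 * (s - s * (\<Sum>i=1..n. x i)) + (\<Sum>i=1..n. c i * (\<lambda>i\<in>{1..n}. s * x i) i)
          = s * (c 0 * (1 - (\<Sum>i=1..n. x i)) + (\<Sum>i=1..n. c i * x i))"
        by (simp add: sum_distrib_left algebra_simps)
      show "K s (\<lambda>i\<in>{1..n}. s * x i) = K 1 x"
        unfolding K_def 1 2 using that by (simp add: mult_le_0_iff zero_less_mult_iff)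
    qed
    finally show ?thesis .
  qed
  have nonpos: "K s x = 0" if "s \<le> 0" for s x
  proof -
    have "(\<Sum>i=1..n. x i) \<ge> 0" if "\<forall>i\<in>{1..n}. 0 < x i"
      using that by (intro sum_nonneg) (auto intro: less_imp_le)
    then show ?thesis using that by (auto simp: K_def)
  qed

  have "?exp = (\<integral>\<^sup>+x. (\<Prod>i\<in>insert 0 {1..n}. ennreal (exp (- x i) * indicator {0<..} (x i))) *
      indicator {x \<in> space ?Pins. (\<Sum>k\<in>insert 0 {1..n}. c k * x k) \<le> 0} x \<partial>?Pins)"
  proof -
    have ins: "{0..n} = insert 0 {1..n}" by auto
    have "Pi\<^sub>M {0..n} (\<lambda>_. std_exponential)
        = density ?Pins (\<lambda>x. \<Prod>i\<in>insert 0 {1..n}. ennreal (exp (- x i) * indicator {0<..} (x i)))"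
      unfolding ins std_exponential_eq
      using E.sigma_finite_measure_axioms
      by (intro PiM_density) (auto simp: std_exponential_eq sigma_finite_lborel)
    then show ?thesis
      unfolding ins by (simp add: emeasure_density del: sum.insert prod.insert)
  qed
  also have "\<dots> = (\<integral>\<^sup>+x. (\<integral>\<^sup>+y. (\<Prod>i\<in>insert 0 {1..n}. ennreal (exp (- (x(0 := y)) i) * indicator {0<..} ((x(0 := y)) i))) *
      indicator {x \<in> space ?Pins. (\<Sum>k\<in>insert 0 {1..n}. c k * x k) \<le> 0} (x(0 := y)) \<partial>lborel) \<partial>?P)"
    by (rule L.product_nn_integral_insert) (auto simp del: sum.insert prod.insert)
  also have "\<dots> = (\<integral>\<^sup>+x. (\<integral>\<^sup>+s. ennreal (exp (- s)) * K s x \<partial>lborel) \<partial>?P)"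
  proof (rule nn_integral_cong)
    fix x assume x: "x \<in> space ?P"
    have "(\<Prod>i\<in>insert 0 {1..n}. ennreal (exp (- (x(0 := y)) i) * indicator {0<..} ((x(0 := y)) i))) *
        indicator {x \<in> space ?Pins. (\<Sum>k\<in>insert 0 {1..n}. c k * x k) \<le> 0} (x(0 := y))
      = ennreal (exp (- ((\<Sum>i=1..n. x i) + 1 * y))) * K ((\<Sum>i=1..n. x i) + 1 * y) x" for y
    proof -
      have sp: "x(0 := y) \<in> space ?Pins"
        using x by (auto simp: space_PiM PiE_def extensional_def)
      have "(\<Prod>i\<in>insert 0 {1..n}. ennreal (exp (- (x(0 := y)) i) * indicator {0<..} ((x(0 := y)) i)))
        = ennreal (exp (- y) * indicator {0<..} y * (\<Prod>i\<in>{1..n}. exp (- x i) * indicator {0<..} (x i)))"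
        by (subst prod_ennreal) (auto simp: intro!: arg_cong[where f = ennreal] prod.cong)
      also have "(\<Prod>i\<in>{1..n}. exp (- x i) * indicator {0<..} (x i)) =
          exp (- (\<Sum>i=1..n. x i)) * (if \<forall>i\<in>{1..n}. 0 < x i then 1 else 0 :: real)"
      proof -
        have "(\<Prod>i\<in>{1..n}. exp (- x i)) = exp (- (\<Sum>i=1..n. x i))"
          by (simp only: exp_sum[symmetric] finite_atLeastAtMost sum_negf)
        moreover have "(\<Prod>i\<in>{1..n}. indicator {0<..} (x i)) = (if \<forall>i\<in>{1..n}. 0 < x i then 1 else 0 :: real)"
          by (auto intro!: prod.neutral prod_zero simp: indicator_def)
        ultimately show ?thesis by (simp only: prod.distrib)
      qed
      also have "exp (- y) * indicator {0<..} y * (exp (- (\<Sum>i=1..n. x i)) * (if \<forall>i\<in>{1..n}. 0 < x i then 1 else 0))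
        = (if 0 < y \<and> (\<forall>i\<in>{1..n}. 0 < x i) then exp (- ((\<Sum>i=1..n. x i) + y)) else 0 :: real)"
        by (simp add: exp_add[symmetric] indicator_def)
      finally have *: "(\<Prod>i\<in>insert 0 {1..n}. ennreal (exp (- (x(0 := y)) i) * indicator {0<..} ((x(0 := y)) i)))
        = ennreal (if 0 < y \<and> (\<forall>i\<in>{1..n}. 0 < x i) then exp (- ((\<Sum>i=1..n. x i) + y)) else 0)" .
      have **: "(\<Sum>k\<in>insert 0 {1..n}. c k * (x(0 := y)) k) = c 0 * y + (\<Sum>i=1..n. c i * x i)"
        by (auto intro!: sum.cong)
      show ?thesis
        unfolding * using sp ** by (auto simp: K_def indicator_def)
    qed
    then show "(\<integral>\<^sup>+y. (\<Prod>i\<in>insert 0 {1..n}. ennreal (exp (- (x(0 := y)) i) * indicator {0<..} ((x(0 := y)) i))) *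
        indicator {x \<in> space ?Pins. (\<Sum>k\<in>insert 0 {1..n}. c k * x k) \<le> 0} (x(0 := y)) \<partial>lborel)
      = (\<integral>\<^sup>+s. ennreal (exp (- s)) * K s x \<partial>lborel)"
      using nn_integral_real_affine[of "\<lambda>s. ennreal (exp (- s)) * K s x" 1 "\<Sum>i=1..n. x i"] K_meas2[of x]
      by simp
  qed
  also have "\<dots> = (\<integral>\<^sup>+s. (\<integral>\<^sup>+x. ennreal (exp (- s)) * K s x \<partial>?P) \<partial>lborel)"
    using K_meas by (intro PL.Fubini'[symmetric]) (auto simp: split_beta')
  also have "\<dots> = (\<integral>\<^sup>+s. (ennreal (s ^ n * exp (- s)) * indicator {0..} s) * ?V \<partial>lborel)"
    \<comment> \<open>At \<open>s = 0\<close> the two integrands may differ when \<open>n = 0\<close>.\<close>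
    using AE_lborel_singleton[of "0::real"]
  proof (intro nn_integral_cong_AE, elim eventually_mono)
    fix s :: real assume "s \<noteq> 0"
    then consider "s > 0" | "s < 0" by linarith
    then show "(\<integral>\<^sup>+x. ennreal (exp (- s)) * K s x \<partial>?P) = (ennreal (s ^ n * exp (- s)) * indicator {0..} s) * ?V"
    proof cases
      case 1
      have "(\<integral>\<^sup>+x. ennreal (exp (- s)) * K s x \<partial>?P) = ennreal (exp (- s)) * (ennreal (s ^ n) * ?V)"
        by (simp only: nn_integral_cmult[OF K_meas1] scale[OF 1])
      with 1 show ?thesis
        by (simp add: ennreal_mult mult_ac)
    qed (simp add: nonpos)
  qed
  also have "\<dots> = ennreal (fact n) * ?V"
    by (subst nn_integral_multc) (auto simp: nn_intergal_power_times_exp_Ici)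
  also have "\<dots> = ?dir"
  proof -
    let ?h = "\<lambda>d. \<lambda>i\<in>{0..n}. if i = 0 then 1 - (\<Sum>j=1..n. d j) else d i :: real"
    let ?D = "density ?P (\<lambda>d. ennreal (dirichlet_density n (\<lambda>_. 1) d))"
    let ?B = "Pi\<^sub>M {0..n} (\<lambda>_. borel) :: (nat \<Rightarrow> real) measure"
    have [measurable]: "(\<lambda>d. dirichlet_density n (\<lambda>_. 1) d) \<in> borel_measurable ?P"
      unfolding dirichlet_density_def by measurable
    have h[measurable]: "?h \<in> measurable ?P ?B"
      by (rule simplex_coordinates_measurable)
    have cone_h: "(\<Sum>k=0..n. c k * ?h d k) = c 0 * (1 - (\<Sum>i=1..n. d i)) + (\<Sum>i=1..n. c i * d i)" for d
    proof -
      have "(\<Sum>k=0..n. c k * ?h d k) = c 0 * ?h d 0 + (\<Sum>k=1..n. c k * ?h d k)"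
        by (subst sum.atLeast_Suc_atMost) (auto simp: One_nat_def)
      then show ?thesis
        by simp
    qed
    let ?cone = "{d \<in> space ?P. c 0 * (1 - (\<Sum>i=1..n. d i)) + (\<Sum>i=1..n. c i * d i) \<le> 0}"
    have "?dir = emeasure (distr ?D ?B ?h) {D \<in> space ?B. (\<Sum>k=0..n. c k * D k) \<le> 0}"
      by (simp add: dirichlet_def)
    also have "\<dots> = emeasure ?D {d \<in> space ?P. (\<Sum>k=0..n. c k * ?h d k) \<le> 0}"
      using measurable_space[OF h]
      by (subst emeasure_distr) (auto intro!: arg_cong2[where f = emeasure])
    also have "\<dots> = emeasure ?D ?cone"
      unfolding cone_h ..
    also have "\<dots> = (\<integral>\<^sup>+d. ennreal (dirichlet_density n (\<lambda>_. 1) d) * indicator ?cone d \<partial>?P)"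
      by (subst emeasure_density) auto
    also have "\<dots> = (\<integral>\<^sup>+d. ennreal (fact n) * K 1 d \<partial>?P)"
      by (intro nn_integral_cong) (auto simp: dirichlet_density_one K_def indicator_def)
    also have "\<dots> = ennreal (fact n) * ?V"
      using K_meas1[of 1] by (intro nn_integral_cmult)
    finally show ?thesis ..
  qed
  finally show ?thesis ..
qed

section \<open>A central limit theorem for weighted sums of exponentials\<close>

text \<open>Multiplying the difference by \<open>1 - \<i> a\<close>, which has modulus at least \<open>1\<close>, reduces the claim to
  comparing \<open>f z = (1 - \<i> z) exp (\<i> z - z\<^sup>2 / 2)\<close> at \<open>a\<close> with its value \<open>1\<close> at \<open>0\<close>. The two quadratic
  expansions cancel in the derivative, which is just \<open>\<i> z\<^sup>2 exp (\<i> z - z\<^sup>2 / 2)\<close> and has modulus at most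
  \<open>a\<^sup>2\<close> on the real segment from \<open>0\<close> to \<open>a\<close>.\<close>

lemma norm_char_exponential_approx:
  "norm (1 / (1 - \<i> * complex_of_real a) - exp (\<i> * complex_of_real a - (complex_of_real a)\<^sup>2 / 2)) \<le> \<bar>a\<bar> ^ 3"
proof -
  define f where "f z = (1 - \<i> * z) * exp (\<i> * z - z\<^sup>2 / 2)" for z :: complex
  define f' where "f' z = \<i> * z\<^sup>2 * exp (\<i> * z - z\<^sup>2 / 2)" for z :: complex
  have re: "Re (1 - \<i> * complex_of_real a) = 1"
    by simp
  then have nz: "1 - \<i> * complex_of_real a \<noteq> 0" and n1: "norm (1 - \<i> * complex_of_real a) \<ge> 1"
    using complex_Re_le_cmod[of "1 - \<i> * complex_of_real a"] by auto
  have "norm (f a - f 0) \<le> a\<^sup>2 * norm (complex_of_real a - 0)"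
  proof (rule field_differentiable_bound[where f' = f' and S = "closed_segment 0 (complex_of_real a)"])
    fix z :: complex assume "z \<in> closed_segment 0 (complex_of_real a)"
    then obtain u where u: "0 \<le> u" "u \<le> 1" and z: "z = complex_of_real (u * a)"
      by (auto simp: closed_segment_def scaleR_conv_of_real)
    show "(f has_field_derivative f' z) (at z within closed_segment 0 (complex_of_real a))"
    proof -
      let ?e = "exp (\<i> * z - z\<^sup>2 / 2)"
      have "((\<lambda>z. exp (\<i> * z - z\<^sup>2 / 2)) has_field_derivative ?e * (\<i> - z)) (at z within closed_segment 0 (complex_of_real a))"
        by (auto intro!: derivative_eq_intros)
      moreover have "((\<lambda>z. 1 - \<i> * z) has_field_derivative - \<i>) (at z within closed_segment 0 (complex_of_real a))"
        by (auto intro!: derivative_eq_intros)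
      ultimately have "(f has_field_derivative (1 - \<i> * z) * (?e * (\<i> - z)) + - \<i> * ?e) (at z within closed_segment 0 (complex_of_real a))"
        unfolding f_def by (rule DERIV_mult'[rotated])
      also have "(1 - \<i> * z) * (?e * (\<i> - z)) + - \<i> * ?e = ((1 - \<i> * z) * (\<i> - z) - \<i>) * ?e"
        by (simp only: ring_distribs mult_ac) simp
      also have "(1 - \<i> * z) * (\<i> - z) - \<i> = \<i> * z\<^sup>2"
        by (simp add: ring_distribs power2_eq_square mult.assoc mult.commute[of z \<i>])
      finally show ?thesis by (simp only: f'_def)
    qed
    have "\<bar>u * a\<bar> \<le> \<bar>a\<bar>"
      using u by (simp add: abs_mult mult_left_le_one_le)
    then have "(u * a)\<^sup>2 \<le> a\<^sup>2"
      by (simp add: abs_le_square_iff)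
    moreover have "norm (f' z) = (u * a)\<^sup>2 * exp (- ((u * a)\<^sup>2 / 2))"
    proof -
      have "norm (f' z) = (norm z)\<^sup>2 * exp (Re (\<i> * z - z\<^sup>2 / 2))"
        unfolding f'_def norm_mult norm_power norm_exp_eq_Re by simp
      also have "Re (\<i> * z - z\<^sup>2 / 2) = - ((u * a)\<^sup>2 / 2)"
        unfolding z by (simp add: power2_eq_square)
      also have "(norm z)\<^sup>2 = (u * a)\<^sup>2"
        unfolding z norm_of_real by simp
      finally show ?thesis .
    qed
    moreover have "(u * a)\<^sup>2 * exp (- ((u * a)\<^sup>2 / 2)) \<le> (u * a)\<^sup>2"
      by (intro mult_left_le) auto
    ultimately show "norm (f' z) \<le> a\<^sup>2"
      by linarith
  qed auto
  moreover have "f 0 = 1"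
    by (simp add: f_def)
  moreover have "a\<^sup>2 * norm (complex_of_real a - 0) = \<bar>a\<bar> ^ 3"
    by (simp add: power2_eq_square power3_eq_cube)
  ultimately have *: "norm (1 - f a) \<le> \<bar>a\<bar> ^ 3"
    by (simp only: norm_minus_commute)
  have "1 / (1 - \<i> * complex_of_real a) - exp (\<i> * complex_of_real a - (complex_of_real a)\<^sup>2 / 2)
      = (1 - f a) / (1 - \<i> * complex_of_real a)"
    using nz by (simp add: f_def field_simps)
  then have "norm (1 / (1 - \<i> * complex_of_real a) - exp (\<i> * complex_of_real a - (complex_of_real a)\<^sup>2 / 2))
      = norm (1 - f a) / norm (1 - \<i> * complex_of_real a)"
    by (simp add: norm_divide)
  also have "\<dots> \<le> norm (1 - f a)"
    using n1 by (simp add: divide_le_eq mult_left_le_one_le mult_le_cancel_left1 mult.commute)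
  finally show ?thesis using * by simp
qed

lemma measure_std_normal_singleton: "measure std_normal_distribution {x} = 0"
proof -
  have "emeasure std_normal_distribution {x} = (\<integral>\<^sup>+y. std_normal_density y * indicator {x} y \<partial>lborel)"
    by (simp add: emeasure_density)
  also have "\<dots> = (\<integral>\<^sup>+(y::real). 0 \<partial>lborel)"
    using AE_lborel_singleton[of x]
    by (intro nn_integral_cong_AE) (auto elim!: eventually_mono)
  finally show ?thesis by (simp add: measure_def)
qed

lemma isCont_cdf_std_normal: "isCont (cdf std_normal_distribution) x"
proof -
  interpret real_distribution std_normal_distribution by (rule real_dist_normal_dist)
  show ?thesis by (simp add: isCont_cdf measure_std_normal_singleton)
qed

lemma char_weighted_exponentials:
  fixes c :: "nat \<Rightarrow> real"
  shows "char (distr (Pi\<^sub>M {0..n} (\<lambda>_. std_exponential)) borel (\<lambda>E. (\<Sum>k=0..n. c k * E k) - m)) t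
   = iexp (- t * m) * (\<Prod>k=0..n. 1 / (1 - \<i> * complex_of_real (t * c k)))"
proof -
  interpret E: real_distribution std_exponential
    by (rule real_distribution_std_exponential)
  interpret P: product_sigma_finite "\<lambda>_::nat. std_exponential" ..
  have [measurable_cong]: "sets std_exponential = sets borel"
    by simp
  have [measurable]: "(\<lambda>E. (\<Sum>k=0..n. c k * E k) - m) \<in> borel_measurable (Pi\<^sub>M {0..n} (\<lambda>_. std_exponential))"
    by measurable
  have "char (distr (Pi\<^sub>M {0..n} (\<lambda>_. std_exponential)) borel (\<lambda>E. (\<Sum>k=0..n. c k * E k) - m)) t
      = (CLINT E|Pi\<^sub>M {0..n} (\<lambda>_. std_exponential). iexp (t * ((\<Sum>k=0..n. c k * E k) - m)))"
    unfolding char_def by (subst integral_distr) auto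
  also have "\<dots> = (CLINT E|Pi\<^sub>M {0..n} (\<lambda>_. std_exponential). iexp (- t * m) * (\<Prod>k=0..n. iexp (t * c k * E k)))"
  proof (intro Bochner_Integration.integral_cong refl)
    fix E :: "nat \<Rightarrow> real"
    have "\<i> * complex_of_real (t * ((\<Sum>k=0..n. c k * E k) - m))
        = \<i> * complex_of_real (- t * m) + (\<Sum>k=0..n. \<i> * complex_of_real (t * c k * E k))"
      by (simp add: sum_distrib_left algebra_simps)
    then show "iexp (t * ((\<Sum>k=0..n. c k * E k) - m)) = iexp (- t * m) * (\<Prod>k=0..n. iexp (t * c k * E k))"
      by (simp only: exp_add exp_sum finite_atLeastAtMost)
  qed
  also have "\<dots> = iexp (- t * m) * (\<Prod>k=0..n. CLINT x|std_exponential. iexp (t * c k * x))"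
    by (subst integral_mult_right_zero, subst P.product_integral_prod) (auto intro!: E.integrable_iexp)
  also have "\<dots> = iexp (- t * m) * (\<Prod>k=0..n. 1 / (1 - \<i> * complex_of_real (t * c k)))"
    by (simp only: char_std_exponential[unfolded char_def])
  finally show ?thesis .
qed

text \<open>The product of the approximating factors \<open>exp (\<i> t c - t\<^sup>2 c\<^sup>2 / 2)\<close> only involves the sums of the
  coefficients and of their squares, and the error made by replacing all factors is at most the sum
  of the individual errors, since all moduli are at most \<open>1\<close>. An exponential variable has mean and
  variance \<open>1\<close>, so \<open>m\<close> and \<open>1\<close> are the limiting mean and variance of the weighted sum.\<close>

lemma clt_weighted_exponentials:
  fixes c :: "nat \<Rightarrow> nat \<Rightarrow> real"
  assumes sum1: "(\<lambda>n. \<Sum>k=0..n. c n k) \<longlonglongrightarrow> m"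
    and sum2: "(\<lambda>n. \<Sum>k=0..n. (c n k)\<^sup>2) \<longlonglongrightarrow> 1"
    and sum3: "(\<lambda>n. \<Sum>k=0..n. \<bar>c n k\<bar> ^ 3) \<longlonglongrightarrow> 0"
  shows "(\<lambda>n. measure (Pi\<^sub>M {0..n} (\<lambda>_. std_exponential))
            {E \<in> space (Pi\<^sub>M {0..n} (\<lambda>_. std_exponential)). (\<Sum>k=0..n. c n k * E k) \<le> 0})
         \<longlonglongrightarrow> cdf std_normal_distribution (- m)"
proof -
  interpret E: real_distribution std_exponential
    by (rule real_distribution_std_exponential)
  interpret P: prob_space "Pi\<^sub>M {0..n} (\<lambda>_. std_exponential)" for n
    by (intro prob_space_PiM E.prob_space_axioms)
  have [measurable_cong]: "sets std_exponential = sets borel"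
    by simp
  let ?N = "\<lambda>n::nat. Pi\<^sub>M {0..n} (\<lambda>_. std_exponential)"
  let ?Y = "\<lambda>n E. (\<Sum>k=0..n. c n k * E k) - m"
  have meas[measurable]: "?Y n \<in> borel_measurable (?N n)" for n
    by measurable
  have "weak_conv_m (\<lambda>n. distr (?N n) borel (?Y n)) std_normal_distribution"
  proof (rule levy_continuity)
    fix t :: real
    define w where "w n = iexp (- t * m) * (\<Prod>k=0..n. exp (\<i> * complex_of_real (t * c n k) - (complex_of_real (t * c n k))\<^sup>2 / 2))" for n
    have "w n = exp (\<i> * complex_of_real (t * ((\<Sum>k=0..n. c n k) - m)) - complex_of_real (t\<^sup>2 * (\<Sum>k=0..n. (c n k)\<^sup>2) / 2))" for n
      unfolding w_def
      by (simp only: exp_sum[symmetric] finite_atLeastAtMost exp_add[symmetric])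
         (simp add: sum_distrib_left sum_subtractf sum_divide_distrib power_mult_distrib algebra_simps)
    moreover have "(\<lambda>n. exp (\<i> * complex_of_real (t * ((\<Sum>k=0..n. c n k) - m)) - complex_of_real (t\<^sup>2 * (\<Sum>k=0..n. (c n k)\<^sup>2) / 2)))
        \<longlonglongrightarrow> exp (\<i> * complex_of_real (t * (m - m)) - complex_of_real (t\<^sup>2 * 1 / 2))"
      by (intro tendsto_intros sum1 sum2) auto
    ultimately have "w \<longlonglongrightarrow> exp (\<i> * complex_of_real (t * (m - m)) - complex_of_real (t\<^sup>2 * 1 / 2))"
      by presburger
    then have w: "w \<longlonglongrightarrow> char std_normal_distribution t"
      by (simp add: char_std_normal_distribution exp_of_real[symmetric])
    have bound: "norm (char (distr (?N n) borel (?Y n)) t - w n) \<le> \<bar>t\<bar> ^ 3 * (\<Sum>k=0..n. \<bar>c n k\<bar> ^ 3)" for n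
    proof -
      have "norm (char (distr (?N n) borel (?Y n)) t - w n) =
          norm ((\<Prod>k=0..n. 1 / (1 - \<i> * complex_of_real (t * c n k))) -
           (\<Prod>k=0..n. exp (\<i> * complex_of_real (t * c n k) - (complex_of_real (t * c n k))\<^sup>2 / 2)))"
        unfolding char_weighted_exponentials w_def right_diff_distrib[symmetric] norm_mult norm_exp_i_times by simp
      also have "\<dots> \<le> (\<Sum>k=0..n. norm (1 / (1 - \<i> * complex_of_real (t * c n k)) -
           exp (\<i> * complex_of_real (t * c n k) - (complex_of_real (t * c n k))\<^sup>2 / 2)))"
      proof (rule norm_prod_diff)
        fix k
        show "norm (1 / (1 - \<i> * complex_of_real (t * c n k))) \<le> 1"
          using complex_Re_le_cmod[of "1 - \<i> * complex_of_real (t * c n k)"]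
          by (simp add: norm_divide divide_le_eq)
        show "norm (exp (\<i> * complex_of_real (t * c n k) - (complex_of_real (t * c n k))\<^sup>2 / 2)) \<le> 1"
          by (simp add: power2_eq_square)
      qed
      also have "\<dots> \<le> (\<Sum>k=0..n. \<bar>t * c n k\<bar> ^ 3)"
        by (intro sum_mono norm_char_exponential_approx)
      also have "\<dots> = \<bar>t\<bar> ^ 3 * (\<Sum>k=0..n. \<bar>c n k\<bar> ^ 3)"
        by (simp add: abs_mult power_mult_distrib sum_distrib_left)
      finally show ?thesis .
    qed
    have "(\<lambda>n. \<bar>t\<bar> ^ 3 * (\<Sum>k=0..n. \<bar>c n k\<bar> ^ 3)) \<longlonglongrightarrow> 0"
      using tendsto_mult_left[OF sum3, of "\<bar>t\<bar> ^ 3"] by simp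
    then have "(\<lambda>n. char (distr (?N n) borel (?Y n)) t - w n) \<longlonglongrightarrow> 0"
      by (rule Lim_null_comparison[rotated]) (intro always_eventually allI bound)
    from tendsto_add[OF this w] show "(\<lambda>n. char (distr (?N n) borel (?Y n)) t) \<longlonglongrightarrow> char std_normal_distribution t"
      by simp
  qed (auto intro: real_dist_normal_dist)
  then have "(\<lambda>n. cdf (distr (?N n) borel (?Y n)) (- m)) \<longlonglongrightarrow> cdf std_normal_distribution (- m)"
    using isCont_cdf_std_normal unfolding weak_conv_m_def weak_conv_def by blast
  moreover have "cdf (distr (?N n) borel (?Y n)) (- m)
      = measure (?N n) {E \<in> space (?N n). (\<Sum>k=0..n. c n k * E k) \<le> 0}" for n
  proof -
    have "cdf (distr (?N n) borel (?Y n)) (- m) = measure (?N n) (?Y n -` {..- m} \<inter> space (?N n))"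
      unfolding cdf_def using meas by (intro measure_distr) simp_all
    also have "?Y n -` {..- m} \<inter> space (?N n) = {E \<in> space (?N n). (\<Sum>k=0..n. c n k * E k) \<le> 0}"
      by (auto simp only: vimage_def Int_iff mem_Collect_eq atMost_iff)
    finally show ?thesis .
  qed
  ultimately show ?thesis by (simp only:)
qed

section \<open>Asymptotic normality of a Dirichlet weighted mean\<close>

text \<open>The normalisation of the density is inherited from the exponential side, by taking the whole space
  as a degenerate cone.\<close>

lemma prob_space_dirichlet_one: "prob_space (dirichlet n (\<lambda>_. 1))"
proof
  interpret E: real_distribution std_exponential
    by (rule real_distribution_std_exponential)
  interpret P: prob_space "Pi\<^sub>M {0..n} (\<lambda>_. std_exponential)"
    by (intro prob_space_PiM E.prob_space_axioms)
  show "emeasure (dirichlet n (\<lambda>_. 1)) (space (dirichlet n (\<lambda>_. 1))) = 1"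
    using emeasure_dirichlet_one_cone[of n "\<lambda>_. 0"] P.emeasure_space_1 by simp
qed

lemma sets_dirichlet [measurable_cong]: "sets (dirichlet n a) = sets (Pi\<^sub>M {0..n} (\<lambda>_. borel))"
  by (simp add: dirichlet_def)

lemma AE_dirichlet_sum_eq_1: "AE D in dirichlet n a. (\<Sum>k=0..n. D k) = 1"
proof -
  let ?P = "Pi\<^sub>M {1..n} (\<lambda>_. lborel) :: (nat \<Rightarrow> real) measure"
  let ?h = "\<lambda>d. \<lambda>i\<in>{0..n}. if i = 0 then 1 - (\<Sum>j=1..n. d j) else d i :: real"
  have h: "?h \<in> measurable ?P (Pi\<^sub>M {0..n} (\<lambda>_. borel))"
    by (rule simplex_coordinates_measurable)
  have "(\<Sum>k=0..n. ?h d k) = 1" for d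
    by (subst sum.atLeast_Suc_atMost) auto
  then show ?thesis
    unfolding dirichlet_def using h by (subst AE_distr_iff) auto
qed

text \<open>Because the weights add up to \<open>1\<close>, the threshold \<open>t\<close> can be moved into the coefficients, which makes
  the condition homogeneous. The positive factor \<open>r\<close> is at the disposal of the caller, to
  normalise the limiting variance.\<close>

lemma measure_dirichlet_one_linear:
  fixes y :: "nat \<Rightarrow> real"
  assumes "r > 0"
  shows "measure (dirichlet n (\<lambda>_. 1)) {D \<in> space (dirichlet n (\<lambda>_. 1)). (\<Sum>k=0..n. y k * D k) \<le> t}
   = measure (Pi\<^sub>M {0..n} (\<lambda>_. std_exponential))
      {E \<in> space (Pi\<^sub>M {0..n} (\<lambda>_. std_exponential)). (\<Sum>k=0..n. (y k - t) / r * E k) \<le> 0}"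
proof -
  interpret prob_space "dirichlet n (\<lambda>_. 1)" by (rule prob_space_dirichlet_one)
  have "AE D in dirichlet n (\<lambda>_. 1). ((\<Sum>k=0..n. y k * D k) \<le> t) \<longleftrightarrow> ((\<Sum>k=0..n. (y k - t) / r * D k) \<le> 0)"
    using AE_dirichlet_sum_eq_1[of n "\<lambda>_. 1"]
  proof eventually_elim
    case (elim D)
    have "(\<Sum>k=0..n. (y k - t) / r * D k) = ((\<Sum>k=0..n. y k * D k) - t * (\<Sum>k=0..n. D k)) / r"
      by (simp add: sum_divide_distrib sum_subtractf sum_distrib_left diff_divide_distrib left_diff_distrib)
    with elim \<open>r > 0\<close> show ?case by (simp add: divide_le_0_iff)
  qed
  then have "measure (dirichlet n (\<lambda>_. 1)) {D \<in> space (dirichlet n (\<lambda>_. 1)). (\<Sum>k=0..n. y k * D k) \<le> t}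
    = measure (dirichlet n (\<lambda>_. 1)) {D \<in> space (dirichlet n (\<lambda>_. 1)). (\<Sum>k=0..n. (y k - t) / r * D k) \<le> 0}"
    by (intro finite_measure_eq_AE) auto
  then show ?thesis
    unfolding measure_def emeasure_dirichlet_one_cone .
qed

lemma sum_atLeast0_conv_head: "(\<Sum>k=0..(n::nat). f k :: real) = f 0 + (\<Sum>k=1..n. f k)"
  by (subst sum.atLeast_Suc_atMost) auto

text \<open>The coefficients are \<open>c k = (y k - t) / (s * sqrt n)\<close>, where \<open>y\<close> is the sample with \<open>b\<close> put in front and
  \<open>t = mean + v / sqrt n\<close>. Deviations from the sample mean add up to \<open>0\<close>, so the coefficients sum to
  \<open>- v / s\<close> and their squares to \<open>(sd / s)\<^sup>2\<close>, up to terms that tend to \<open>0\<close>. Each single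
  coefficient is of order \<open>1 / sqrt n\<close>, so the cubes are negligible against the squares.\<close>

lemma dirichlet_mean_clt:
  fixes x :: "nat \<Rightarrow> real"
  assumes x: "\<And>i. i \<ge> 1 \<Longrightarrow> x i \<in> {0..1}" and b: "b \<in> {0..1}"
    and sd: "(\<lambda>n. sample_sd n x) \<longlonglongrightarrow> s" and "s > 0"
  shows "(\<lambda>n. measure (dirichlet n (\<lambda>_. 1)) {D \<in> space (dirichlet n (\<lambda>_. 1)).
            b * D 0 + (\<Sum>i=1..n. x i * D i) \<le> sample_mean n x + v / sqrt (real n)})
         \<longlonglongrightarrow> cdf std_normal_distribution (v / s)"
proof -
  define y where "y k = (if k = 0 then b else x k)" for k
  define t where "t n = sample_mean n x + v / sqrt (real n)" for n
  define c where "c n k = (y k - t n) / (s * sqrt (real n))" for n k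
  have mean: "sample_mean n x \<in> {0..1}" for n
  proof -
    have "0 \<le> (\<Sum>i=1..n. x i)" "(\<Sum>i=1..n. x i) \<le> (\<Sum>i=1..n. 1)"
      using x by (auto intro!: sum_nonneg sum_mono simp del: sum_constant)
    then have "0 \<le> (\<Sum>i=1..n. x i)" "(\<Sum>i=1..n. x i) \<le> real n"
      by simp_all
    then show ?thesis by (auto simp: sample_mean_def divide_le_eq simp del: One_nat_def)
  qed
  have mean_sum: "(\<Sum>i=1..n. x i) = n * sample_mean n x" for n
    by (cases "n = 0") (auto simp: sample_mean_def)
  have dev_sum: "(\<Sum>i=1..n. (x i - sample_mean n x)\<^sup>2) = n * (sample_sd n x)\<^sup>2" for n
    by (cases "n = 0") (auto simp: sample_sd_def sum_nonneg)
  have root: "(\<lambda>n. 1 / sqrt (real n)) \<longlonglongrightarrow> 0"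
    by real_asymp
  define B where "B = 2 + \<bar>v\<bar>"
  have yt: "\<bar>y k - t n\<bar> \<le> B" if "n \<ge> 1" for k n
  proof -
    have "y k \<in> {0..1}" using x[of k] b by (auto simp: y_def)
    moreover have "\<bar>v / sqrt (real n)\<bar> \<le> \<bar>v\<bar>"
      using that by (simp add: abs_divide divide_le_eq mult_le_cancel_left1)
    ultimately show ?thesis
      using mean[of n] unfolding t_def B_def atLeastAtMost_iff by linarith
  qed
  have c_abs: "\<bar>c n k\<bar> \<le> B / s * (1 / sqrt (real n))" if "n \<ge> 1" for n k
    using yt[OF that, of k] \<open>s > 0\<close> that by (simp add: c_def abs_mult divide_right_mono)
  have c0: "(\<lambda>n. c n 0) \<longlonglongrightarrow> 0"
  proof (rule Lim_null_comparison)
    show "\<forall>\<^sub>F n in sequentially. norm (c n 0) \<le> B / s * (1 / sqrt (real n))"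
      using eventually_ge_at_top[of "1::nat"] by eventually_elim (use c_abs in auto)
    show "(\<lambda>n. B / s * (1 / sqrt (real n))) \<longlonglongrightarrow> 0"
      using tendsto_mult_left[OF root, of "B / s"] by simp
  qed
  have sum1_eq: "(\<Sum>k=0..n. c n k) = c n 0 - v / s" if "n \<ge> 1" for n
  proof -
    have "(\<Sum>k=1..n. c n k) = (\<Sum>k=1..n. x k - t n) / (s * sqrt (real n))"
      by (simp add: c_def y_def sum_divide_distrib)
    also have "(\<Sum>k=1..n. x k - t n) = - v * sqrt n"
      using that by (simp only: sum_subtractf mean_sum) (simp add: t_def field_simps real_sqrt_mult[symmetric])
    finally have "(\<Sum>k=1..n. c n k) = - v / s"
      using that by simp
    then show ?thesis by (simp only: sum_atLeast0_conv_head)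
  qed
  have sum2_eq: "(\<Sum>k=0..n. (c n k)\<^sup>2) = (c n 0)\<^sup>2 + (sample_sd n x / s)\<^sup>2 + (v / s * (1 / sqrt n))\<^sup>2" if "n \<ge> 1" for n
  proof -
    have "(\<Sum>k=1..n. (c n k)\<^sup>2) = (\<Sum>k=1..n. (x k - t n)\<^sup>2) / (s\<^sup>2 * n)"
      by (simp add: c_def y_def sum_divide_distrib power_divide power_mult_distrib)
    also have "(\<Sum>k=1..n. (x k - t n)\<^sup>2)
        = (\<Sum>k=1..n. (x k - sample_mean n x)\<^sup>2 - 2 * (v / sqrt n) * (x k - sample_mean n x) + (v / sqrt n)\<^sup>2)"
    proof (intro sum.cong refl)
      have "(p - (q + r))\<^sup>2 = (p - q)\<^sup>2 - 2 * r * (p - q) + r\<^sup>2" for p q r :: real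
        by (simp add: power2_eq_square algebra_simps)
      then show "(x k - t n)\<^sup>2 = (x k - sample_mean n x)\<^sup>2 - 2 * (v / sqrt n) * (x k - sample_mean n x) + (v / sqrt n)\<^sup>2" for k
        unfolding t_def .
    qed
    also have "\<dots> = n * (sample_sd n x)\<^sup>2 - 2 * (v / sqrt n) * (\<Sum>k=1..n. x k - sample_mean n x) + n * (v / sqrt n)\<^sup>2"
      by (simp only: sum.distrib sum_subtractf dev_sum sum_distrib_left[symmetric]) (simp add: sum_distrib_left)
    also have "(\<Sum>k=1..n. x k - sample_mean n x) = 0"
      by (simp only: sum_subtractf mean_sum) simp
    finally have "(\<Sum>k=1..n. (c n k)\<^sup>2) = (sample_sd n x / s)\<^sup>2 + (v / s * (1 / sqrt n))\<^sup>2"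
      using that \<open>s > 0\<close> by (simp add: power_divide power_mult_distrib field_simps)
    then show ?thesis by (simp only: sum_atLeast0_conv_head)
  qed
  have lim1: "(\<lambda>n. \<Sum>k=0..n. c n k) \<longlonglongrightarrow> - (v / s)"
  proof (rule Lim_transform_eventually)
    show "(\<lambda>n. c n 0 - v / s) \<longlonglongrightarrow> - (v / s)"
      using tendsto_diff[OF c0 tendsto_const, of "v / s"] by simp
    show "\<forall>\<^sub>F n in sequentially. c n 0 - v / s = (\<Sum>k=0..n. c n k)"
      using eventually_ge_at_top[of "1::nat"] by eventually_elim (simp only: sum1_eq)
  qed
  have lim2: "(\<lambda>n. \<Sum>k=0..n. (c n k)\<^sup>2) \<longlonglongrightarrow> 1"
  proof (rule Lim_transform_eventually)
    have "(\<lambda>n. (c n 0)\<^sup>2 + (sample_sd n x / s)\<^sup>2 + (v / s * (1 / sqrt n))\<^sup>2) \<longlonglongrightarrow> 0\<^sup>2 + (s / s)\<^sup>2 + (v / s * 0)\<^sup>2"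
      using \<open>s > 0\<close> by (intro tendsto_intros c0 sd root) auto
    then show "(\<lambda>n. (c n 0)\<^sup>2 + (sample_sd n x / s)\<^sup>2 + (v / s * (1 / sqrt n))\<^sup>2) \<longlonglongrightarrow> 1"
      using \<open>s > 0\<close> by simp
    show "\<forall>\<^sub>F n in sequentially. (c n 0)\<^sup>2 + (sample_sd n x / s)\<^sup>2 + (v / s * (1 / sqrt n))\<^sup>2 = (\<Sum>k=0..n. (c n k)\<^sup>2)"
      using eventually_ge_at_top[of "1::nat"] by eventually_elim (simp only: sum2_eq)
  qed
  have lim3: "(\<lambda>n. \<Sum>k=0..n. \<bar>c n k\<bar> ^ 3) \<longlonglongrightarrow> 0"
  proof (rule Lim_null_comparison)
    show "(\<lambda>n. B / s * (1 / sqrt (real n)) * (\<Sum>k=0..n. (c n k)\<^sup>2)) \<longlonglongrightarrow> 0"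
      using tendsto_mult[OF tendsto_mult_left[OF root, of "B / s"] lim2] by simp
    show "\<forall>\<^sub>F n in sequentially. norm (\<Sum>k=0..n. \<bar>c n k\<bar> ^ 3) \<le> B / s * (1 / sqrt (real n)) * (\<Sum>k=0..n. (c n k)\<^sup>2)"
      using eventually_ge_at_top[of "1::nat"]
    proof eventually_elim
      case (elim n)
      have "(\<Sum>k=0..n. \<bar>c n k\<bar> ^ 3) = (\<Sum>k=0..n. \<bar>c n k\<bar> * (c n k)\<^sup>2)"
        by (simp add: power3_eq_cube power2_eq_square mult_ac)
      also have "\<dots> \<le> (\<Sum>k=0..n. B / s * (1 / sqrt (real n)) * (c n k)\<^sup>2)"
        using c_abs[OF elim] by (intro sum_mono mult_right_mono) auto
      also have "\<dots> = B / s * (1 / sqrt (real n)) * (\<Sum>k=0..n. (c n k)\<^sup>2)"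
        by (simp only: sum_distrib_left)
      finally show ?case by (simp add: sum_nonneg)
    qed
  qed
  have "(\<lambda>n. measure (Pi\<^sub>M {0..n} (\<lambda>_. std_exponential))
            {E \<in> space (Pi\<^sub>M {0..n} (\<lambda>_. std_exponential)). (\<Sum>k=0..n. c n k * E k) \<le> 0})
         \<longlonglongrightarrow> cdf std_normal_distribution (v / s)"
    using clt_weighted_exponentials[OF lim1 lim2 lim3] by simp
  moreover have "\<forall>\<^sub>F n in sequentially.
     measure (Pi\<^sub>M {0..n} (\<lambda>_. std_exponential))
            {E \<in> space (Pi\<^sub>M {0..n} (\<lambda>_. std_exponential)). (\<Sum>k=0..n. c n k * E k) \<le> 0}
     = measure (dirichlet n (\<lambda>_. 1)) {D \<in> space (dirichlet n (\<lambda>_. 1)).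
            b * D 0 + (\<Sum>i=1..n. x i * D i) \<le> sample_mean n x + v / sqrt (real n)}"
    using eventually_ge_at_top[of "1::nat"]
  proof eventually_elim
    case (elim n)
    have "b * D 0 + (\<Sum>i=1..n. x i * D i) = (\<Sum>k=0..n. y k * D k)" for D
      unfolding sum_atLeast0_conv_head by (simp add: y_def)
    moreover have "s * sqrt (real n) > 0" using elim \<open>s > 0\<close> by simp
    ultimately show ?case
      unfolding c_def t_def[symmetric] by (simp only: measure_dirichlet_one_linear)
  qed
  ultimately show ?thesis by (rule Lim_transform_eventually)
qed

section \<open>Quantiles under a normal limit\<close>

lemma strict_mono_cdf_std_normal: "strict_mono (cdf std_normal_distribution)"
proof (rule strict_monoI)
  interpret real_distribution std_normal_distribution by (rule real_dist_normal_dist)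
  fix x y :: real assume "x < y"
  have "emeasure std_normal_distribution {x<..y} \<noteq> 0"
  proof
    assume "emeasure std_normal_distribution {x<..y} = 0"
    then have "(\<integral>\<^sup>+z. ennreal (std_normal_density z) * indicator {x<..y} z \<partial>lborel) = 0"
      by (subst (asm) emeasure_density) auto
    then have "AE z in lborel. ennreal (std_normal_density z) * indicator {x<..y} z = 0"
      by (subst (asm) nn_integral_0_iff_AE) auto
    then have "AE z in lborel. z \<notin> {x<..y}"
    proof eventually_elim
      case (elim z)
      moreover have "std_normal_density z > 0"
        by (simp add: normal_density_pos)
      ultimately show ?case by (auto simp: indicator_def)
    qed
    then have "emeasure lborel {x<..y} = 0"
      by (subst (asm) AE_iff_measurable[of "{x<..y}"]) auto
    with \<open>x < y\<close> show False by simp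
  qed
  then have "0 < measure std_normal_distribution {x<..y}"
    by (simp add: emeasure_eq_measure zero_less_measure_iff)
  then show "cdf std_normal_distribution x < cdf std_normal_distribution y"
    using cdf_diff_eq[OF \<open>x < y\<close>] by simp
qed

lemma cdf_std_normal_quantile:
  assumes "q \<in> {0<..<1}"
  shows "cdf std_normal_distribution (std_normal_quantile q) = q"
proof -
  interpret real_distribution std_normal_distribution by (rule real_dist_normal_dist)
  let ?F = "cdf std_normal_distribution"
  obtain a where a: "?F a < q"
    using order_tendstoD(2)[OF cdf_lim_at_bot, of q] assms
    by (auto dest: eventually_happens'[OF trivial_limit_at_bot_linorder])
  obtain b where b: "q < ?F b"
    using order_tendstoD(1)[OF cdf_lim_at_top_prob, of q] assms
    by (auto dest: eventually_happens'[OF trivial_limit_at_top_linorder])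
  have "a \<le> b"
    using a b strict_mono_less[OF strict_mono_cdf_std_normal, of b a] by linarith
  then obtain z where "?F z = q"
    using IVT[of ?F a q b] a b isCont_cdf_std_normal by auto
  then show ?thesis
    unfolding std_normal_quantile_def by (intro f_inv_into_f) auto
qed

lemma quantile_le_iff:
  assumes "prob_space N" and [measurable]: "Y \<in> borel_measurable N" and q: "q \<in> {0<..<1}"
  shows "quantile N Y q \<le> t \<longleftrightarrow> q \<le> measure N {\<omega> \<in> space N. Y \<omega> \<le> t}"
proof -
  interpret prob_space N by fact
  interpret D: cdf_distribution "distr N borel Y"
    unfolding cdf_distribution_def by simp
  have "cdf (distr N borel Y) u = measure N {\<omega> \<in> space N. Y \<omega> \<le> u}" for u
    unfolding cdf_def by (subst measure_distr) (auto intro!: arg_cong2[where f = measure])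
  then show ?thesis
    using D.pseudoinverse[of q t] q by (simp add: quantile_def)
qed

text \<open>The rescaled quantile is at most \<open>v\<close> exactly when the probability at \<open>v\<close> has reached the level \<open>q\<close>. Its
  limit \<open>\<Phi> (v / s)\<close> lies strictly below \<open>q\<close> for \<open>v < s z\<close> and strictly above for \<open>v > s z\<close>, and in
  both cases the comparison is eventually decided the same way.\<close>

lemma quantile_normal_limit:
  assumes N: "\<And>n. prob_space (N n)" and Y: "\<And>n. Y n \<in> borel_measurable (N n)"
    and q: "q \<in> {0<..<1}" and "s > 0"
    and lim: "\<And>v. (\<lambda>n. measure (N n) {\<omega> \<in> space (N n). Y n \<omega> \<le> a n + v / sqrt (real n)})
                 \<longlonglongrightarrow> cdf std_normal_distribution (v / s)"
  shows "(\<lambda>n. sqrt (real n) * (quantile (N n) (Y n) q - a n)) \<longlonglongrightarrow> s * std_normal_quantile q"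
proof -
  let ?z = "std_normal_quantile q"
  have iff: "sqrt (real n) * (quantile (N n) (Y n) q - a n) \<le> v
      \<longleftrightarrow> q \<le> measure (N n) {\<omega> \<in> space (N n). Y n \<omega> \<le> a n + v / sqrt (real n)}" if "n \<ge> 1" for n v
    using that unfolding quantile_le_iff[OF N Y q, symmetric] by (simp add: field_simps)
  show ?thesis
  proof (rule order_tendstoI)
    fix w assume "w < s * ?z"
    then have "w / s < ?z"
      using \<open>s > 0\<close> by (simp add: divide_less_eq mult.commute)
    then have "cdf std_normal_distribution (w / s) < q"
      using strict_monoD[OF strict_mono_cdf_std_normal] cdf_std_normal_quantile[OF q] by metis
    from order_tendstoD(2)[OF lim this] eventually_ge_at_top[of 1]
    show "\<forall>\<^sub>F n in sequentially. w < sqrt (real n) * (quantile (N n) (Y n) q - a n)"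
    proof eventually_elim
      case (elim n)
      with iff[of n w] show ?case by linarith
    qed
  next
    fix w assume "s * ?z < w"
    then obtain v where v: "s * ?z < v" "v < w"
      using dense by blast
    then have "?z < v / s"
      using \<open>s > 0\<close> by (simp add: less_divide_eq mult.commute)
    then have "q < cdf std_normal_distribution (v / s)"
      using strict_monoD[OF strict_mono_cdf_std_normal] cdf_std_normal_quantile[OF q] by metis
    from order_tendstoD(1)[OF lim this] eventually_ge_at_top[of 1]
    show "\<forall>\<^sub>F n in sequentially. sqrt (real n) * (quantile (N n) (Y n) q - a n) < w"
    proof eventually_elim
      case (elim n)
      with iff[of n v] v show ?case by linarith
    qed
  qed
qed

section \<open>The endpoints for a fixed sample\<close>

lemma gaffke_endpoint_measurable:
  "(\<lambda>D. b * D 0 + (\<Sum>i=1..n. x i * D i)) \<in> borel_measurable (dirichlet n a)"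
  by measurable

lemma
  fixes x :: "nat \<Rightarrow> real"
  assumes x: "\<And>i. i \<ge> 1 \<Longrightarrow> x i \<in> {0..1}"
    and sd: "(\<lambda>n. sample_sd n x) \<longlonglongrightarrow> s" and "s > 0" and \<alpha>: "\<alpha> \<in> {0<..<1}"
  shows gaffke_lower_limit:
      "(\<lambda>n. sqrt (real n) * (gaffke_lower n \<alpha> x - sample_mean n x)) \<longlonglongrightarrow> s * std_normal_quantile \<alpha>" (is ?L)
    and gaffke_upper_limit:
      "(\<lambda>n. sqrt (real n) * (gaffke_upper n \<alpha> x - sample_mean n x)) \<longlonglongrightarrow> s * std_normal_quantile (1 - \<alpha>)" (is ?U)
proof -
  have lim: "(\<lambda>n. sqrt (real n) * (quantile (dirichlet n (\<lambda>_. 1))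
        (\<lambda>D. b * D 0 + (\<Sum>i=1..n. x i * D i)) q - sample_mean n x)) \<longlonglongrightarrow> s * std_normal_quantile q"
    if "b \<in> {0..1}" "q \<in> {0<..<1}" for b q
    using that x sd \<open>s > 0\<close>
    by (intro quantile_normal_limit prob_space_dirichlet_one gaffke_endpoint_measurable dirichlet_mean_clt)
  show ?L
    using lim[of 0 \<alpha>] \<alpha> by (simp add: gaffke_lower_def)
  show ?U
    using lim[of 1 "1 - \<alpha>"] \<alpha> by (simp add: gaffke_upper_def)
qed

lemma smallo_inverse_sqrt:
  assumes "(\<lambda>n. sqrt (real n) * (f n - a n)) \<longlonglongrightarrow> s * z" and "b \<longlonglongrightarrow> s"
  shows "(\<lambda>n. f n - (a n + b n / sqrt (real n) * z)) \<in> o(\<lambda>n. real n powr (- 1 / 2))"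
proof (rule smalloI_tendsto)
  have "(\<lambda>n. sqrt (real n) * (f n - a n) - b n * z) \<longlonglongrightarrow> s * z - s * z"
    by (intro tendsto_intros assms)
  moreover have "\<forall>\<^sub>F n in sequentially. sqrt (real n) * (f n - a n) - b n * z
      = (f n - (a n + b n / sqrt (real n) * z)) / real n powr (- 1 / 2)"
    using eventually_ge_at_top[of 1]
  proof eventually_elim
    case (elim n)
    then have "real n powr (- 1 / 2) = 1 / sqrt (real n)"
      using powr_minus[of "real n" "1 / 2"] powr_half_sqrt[of "real n"] by (simp add: inverse_eq_divide)
    moreover have "b n / sqrt (real n) * z * sqrt (real n) = b n * z"
      using elim by simp
    ultimately show ?case
      by (simp only: divide_divide_eq_right div_by_1) (simp add: ring_distribs mult.commute)
  qed
  ultimately show "(\<lambda>n. (f n - (a n + b n / sqrt (real n) * z)) / real n powr (- 1 / 2)) \<longlonglongrightarrow> 0"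
    by (auto dest: Lim_transform_eventually)
  show "\<forall>\<^sub>F n in sequentially. real n powr (- 1 / 2) \<noteq> 0"
    using eventually_ge_at_top[of 1] by eventually_elim simp
qed

section \<open>Consistency of the sample mean and standard deviation\<close>

text \<open>For variables in the unit interval, Hoeffding's inequality bounds the probability of a deviation
  by \<open>\<epsilon>\<close> by a geometric sequence, so that the Borel-Cantelli lemma applies.\<close>

lemma (in prob_space) slln_unit_interval:
  fixes X :: "nat \<Rightarrow> 'a \<Rightarrow> real"
  assumes indep: "indep_vars (\<lambda>_. borel) X {1..}"
    and distr: "\<And>i. i \<ge> 1 \<Longrightarrow> distr M borel (X i) = distr M borel (X 1)"
    and range: "\<And>i \<omega>. i \<ge> 1 \<Longrightarrow> \<omega> \<in> space M \<Longrightarrow> X i \<omega> \<in> {0..1}"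
  shows "AE \<omega> in M. (\<lambda>n. (\<Sum>i=1..n. X i \<omega>) / real n) \<longlonglongrightarrow> expectation (X 1)"
proof -
  let ?m = "expectation (X 1)"
  have rv[measurable]: "X i \<in> borel_measurable M" if "i \<ge> 1" for i
    using indep that by (auto simp: indep_vars_def)
  have rvS[measurable]: "(\<lambda>\<omega>. (\<Sum>i=1..n. X i \<omega>) / real n) \<in> borel_measurable M" for n
    by (intro borel_measurable_divide borel_measurable_sum) auto
  have close: "AE \<omega> in M. \<forall>\<^sub>F n in sequentially. \<bar>(\<Sum>i=1..n. X i \<omega>) / real n - ?m\<bar> < \<epsilon>" if "\<epsilon> > 0" for \<epsilon>
  proof -
    let ?A = "\<lambda>n. {\<omega> \<in> space M. \<bar>(\<Sum>i=1..n. X i \<omega>) / real n - ?m\<bar> \<ge> \<epsilon>}"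
    have bound: "measure M (?A n) \<le> 2 * exp (- 2 * \<epsilon>\<^sup>2) ^ n" if "n \<ge> 1" for n
    proof -
      have "Hoeffding_ineq_iid M {1..n} X (X 1) 0 1"
        unfolding Hoeffding_ineq_iid_def iid_interval_bounded_random_variables_def
          iid_interval_bounded_random_variables_axioms_def
      proof (intro conjI allI impI)
        show "indep_vars (\<lambda>_. borel) X {1..n}"
          using indep by (rule indep_vars_subset) auto
        show "AE \<omega> in M. X 1 \<omega> \<in> {0..1}"
          by (intro AE_I2 range) simp_all
        show "random_variable borel (X 1)"
          by (rule rv) simp
        fix i assume "i \<in> {1..n}"
        then have "i \<ge> 1" by simp
        then show "distr M borel (X i) = distr M borel (X 1)"
          by (rule distr)
      qed (rule prob_space_axioms finite_atLeastAtMost)+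
      then have "measure M (?A n) \<le> 2 * exp (- 2 * real (card {1..n}) * \<epsilon>\<^sup>2 / (1 - 0)\<^sup>2)"
        using Hoeffding_ineq_iid.Hoeffding_ineq_abs_ge'[of M "{1..n}" X "X 1" 0 1 \<epsilon>] that \<open>\<epsilon> > 0\<close>
        by simp
      then have "measure M (?A n) \<le> 2 * exp (- 2 * real n * \<epsilon>\<^sup>2)"
        by simp
      also have "exp (- 2 * real n * \<epsilon>\<^sup>2) = exp (- 2 * \<epsilon>\<^sup>2) ^ n"
        by (simp add: exp_of_nat_mult[symmetric] mult_ac)
      finally show ?thesis .
    qed
    have "summable (\<lambda>n. measure M (?A n))"
    proof (rule summable_comparison_test)
      show "\<exists>N. \<forall>n\<ge>N. norm (measure M (?A n)) \<le> 2 * exp (- 2 * \<epsilon>\<^sup>2) ^ n"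
        using bound by (intro exI[of _ 1]) simp
      show "summable (\<lambda>n. 2 * exp (- 2 * \<epsilon>\<^sup>2) ^ n)"
        using \<open>\<epsilon> > 0\<close> by (intro summable_mult summable_geometric) simp
    qed
    then have "AE \<omega> in M. \<forall>\<^sub>F n in sequentially. \<omega> \<in> space M - ?A n"
      by (intro borel_cantelli_AE1) (auto simp: emeasure_eq_measure)
    then show ?thesis
      by eventually_elim (auto elim!: eventually_mono)
  qed
  have "AE \<omega> in M. \<forall>k::nat. \<forall>\<^sub>F n in sequentially. \<bar>(\<Sum>i=1..n. X i \<omega>) / real n - ?m\<bar> < inverse (real (Suc k))"
    unfolding AE_all_countable by (intro allI close) simp
  then show ?thesis
  proof eventually_elim
    case (elim \<omega>)
    show ?case
    proof (rule tendstoI)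
      fix e :: real assume "e > 0"
      then obtain k where "inverse (real (Suc k)) < e"
        using reals_Archimedean by blast
      with elim[rule_format, of k] show "\<forall>\<^sub>F n in sequentially. dist ((\<Sum>i=1..n. X i \<omega>) / real n) ?m < e"
        by (auto simp: dist_real_def elim: eventually_mono)
    qed
  qed
qed

text \<open>The squares are again independent, identically distributed and in the unit interval, so the strong
  law applies to them as well, and the sample variance is the mean of the squares minus the
  square of the mean.\<close>

lemma (in prob_space) sample_sd_consistent:
  fixes X :: "nat \<Rightarrow> 'a \<Rightarrow> real"
  assumes indep: "indep_vars (\<lambda>_. borel) X {1..}"
    and distr: "\<And>i. i \<ge> 1 \<Longrightarrow> distr M borel (X i) = distr M borel (X 1)"
    and range: "\<And>i \<omega>. i \<ge> 1 \<Longrightarrow> \<omega> \<in> space M \<Longrightarrow> X i \<omega> \<in> {0..1}"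
    and var: "variance (X 1) = \<sigma>\<^sup>2" and "\<sigma> > 0"
  shows "AE \<omega> in M. (\<lambda>n. sample_sd n (\<lambda>i. X i \<omega>)) \<longlonglongrightarrow> \<sigma>"
proof -
  have rv[measurable]: "X i \<in> borel_measurable M" if "i \<ge> 1" for i
    using indep that by (auto simp: indep_vars_def)
  have int1: "integrable M (X 1)"
    using range[of 1] by (intro integrable_const_bound[of _ 1]) auto
  have int2: "integrable M (\<lambda>\<omega>. (X 1 \<omega>)\<^sup>2)"
    using range[of 1] by (intro integrable_const_bound[of _ 1]) (auto simp: power_le_one)
  have sq: "AE \<omega> in M. (\<lambda>n. (\<Sum>i=1..n. (X i \<omega>)\<^sup>2) / real n) \<longlonglongrightarrow> expectation (\<lambda>\<omega>. (X 1 \<omega>)\<^sup>2)"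
  proof (rule slln_unit_interval)
    show "indep_vars (\<lambda>_. borel) (\<lambda>i \<omega>. (X i \<omega>)\<^sup>2) {1..}"
      by (rule indep_vars_compose2[OF indep]) auto
    show "distr M borel (\<lambda>\<omega>. (X i \<omega>)\<^sup>2) = distr M borel (\<lambda>\<omega>. (X 1 \<omega>)\<^sup>2)" if "i \<ge> 1" for i
    proof -
      have "distr M borel (\<lambda>\<omega>. (X j \<omega>)\<^sup>2) = distr (distr M borel (X j)) borel (\<lambda>z. z\<^sup>2)" if "j \<ge> 1" for j
        using that by (subst distr_distr) (auto simp: comp_def)
      then show ?thesis using distr[OF that] that by simp
    qed
    show "(X i \<omega>)\<^sup>2 \<in> {0..1}" if "i \<ge> 1" "\<omega> \<in> space M" for i \<omega>
      using range[OF that] by (simp add: power_le_one)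
  qed
  have "AE \<omega> in M. (\<lambda>n. (\<Sum>i=1..n. X i \<omega>) / real n) \<longlonglongrightarrow> expectation (X 1)"
    using indep distr range by (rule slln_unit_interval)
  from this sq show ?thesis
  proof eventually_elim
    case (elim \<omega>)
    let ?x = "\<lambda>i. X i \<omega>"
    have "(\<lambda>n. sqrt ((\<Sum>i=1..n. (?x i)\<^sup>2) / real n - ((\<Sum>i=1..n. ?x i) / real n)\<^sup>2))
        \<longlonglongrightarrow> sqrt (expectation (\<lambda>\<omega>. (X 1 \<omega>)\<^sup>2) - (expectation (X 1))\<^sup>2)"
      by (intro tendsto_intros elim)
    also have "expectation (\<lambda>\<omega>. (X 1 \<omega>)\<^sup>2) - (expectation (X 1))\<^sup>2 = \<sigma>\<^sup>2"
      using variance_eq[OF int1 int2] var by simp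
    also have "sqrt (\<sigma>\<^sup>2) = \<sigma>"
      using \<open>\<sigma> > 0\<close> by simp
    finally have lim: "(\<lambda>n. sqrt ((\<Sum>i=1..n. (?x i)\<^sup>2) / real n - ((\<Sum>i=1..n. ?x i) / real n)\<^sup>2)) \<longlonglongrightarrow> \<sigma>" .
    have "sqrt ((\<Sum>i=1..n. (?x i)\<^sup>2) / real n - ((\<Sum>i=1..n. ?x i) / real n)\<^sup>2) = sample_sd n ?x" if "n \<ge> 1" for n
    proof -
      let ?m = "sample_mean n ?x"
      have m: "(\<Sum>i=1..n. ?x i) = n * ?m"
        using that by (simp add: sample_mean_def)
      have "(\<Sum>i=1..n. (?x i - ?m)\<^sup>2) = (\<Sum>i=1..n. (?x i)\<^sup>2 - 2 * ?m * ?x i + ?m\<^sup>2)"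
        by (intro sum.cong refl) (simp add: power2_eq_square algebra_simps)
      also have "\<dots> = (\<Sum>i=1..n. (?x i)\<^sup>2) - 2 * ?m * (n * ?m) + n * ?m\<^sup>2"
        by (simp only: sum.distrib sum_subtractf sum_distrib_left[symmetric] m) simp
      also have "\<dots> = (\<Sum>i=1..n. (?x i)\<^sup>2) - n * ?m\<^sup>2"
        by (simp add: power2_eq_square)
      finally have "(\<Sum>i=1..n. (?x i - ?m)\<^sup>2) / real n = (\<Sum>i=1..n. (?x i)\<^sup>2) / real n - ?m\<^sup>2"
        using that by (simp add: diff_divide_distrib)
      then show ?thesis
        unfolding sample_sd_def by (simp add: sample_mean_def)
    qed
    then have "\<forall>\<^sub>F n in sequentially. sqrt ((\<Sum>i=1..n. (?x i)\<^sup>2) / real n - ((\<Sum>i=1..n. ?x i) / real n)\<^sup>2) = sample_sd n ?x"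
      by (rule eventually_mono[OF eventually_ge_at_top[of "1::nat"]])
    with lim show ?case
      by (rule Lim_transform_eventually)
  qed
qed

section \<open>Comparing an asymptotically normal variable with convergent bounds\<close>

text \<open>One half of Slutsky's theorem. The characteristic functions differ by at most the mean of
  \<open>\<bar>exp (\<i> t A) - 1\<bar>\<close>, which tends to \<open>0\<close> by dominated convergence.\<close>

lemma (in prob_space) weak_conv_add_null_sequence:
  fixes V A :: "nat \<Rightarrow> 'a \<Rightarrow> real"
  assumes V[measurable]: "\<And>n. V n \<in> borel_measurable M" and A[measurable]: "\<And>n. A n \<in> borel_measurable M"
    and N: "real_distribution N"
    and lim: "weak_conv_m (\<lambda>n. distr M borel (V n)) N"
    and null: "AE \<omega> in M. (\<lambda>n. A n \<omega>) \<longlonglongrightarrow> 0"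
  shows "weak_conv_m (\<lambda>n. distr M borel (\<lambda>\<omega>. V n \<omega> + A n \<omega>)) N"
proof (rule levy_continuity)
  fix t :: real
  have bnd: "norm (iexp (t * x) - 1) \<le> 2" for x
    using norm_triangle_ineq4[of "iexp (t * x)" 1] by simp
  have int: "integrable M (\<lambda>\<omega>. iexp (t * f \<omega>))" if "f \<in> borel_measurable M" for f
    using that by (intro integrable_const_bound[of _ 1]) auto
  have "(\<lambda>n. \<integral>\<omega>. norm (iexp (t * A n \<omega>) - 1) \<partial>M) \<longlonglongrightarrow> (\<integral>\<omega>. 0 \<partial>M)"
  proof (rule integral_dominated_convergence[where w = "\<lambda>_. 2"])
    show "AE \<omega> in M. (\<lambda>n. norm (iexp (t * A n \<omega>) - 1)) \<longlonglongrightarrow> 0"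
      using null
    proof eventually_elim
      case (elim \<omega>)
      have "(\<lambda>n. norm (iexp (t * A n \<omega>) - 1)) \<longlonglongrightarrow> norm (iexp (t * 0) - 1)"
        by (intro tendsto_intros elim)
      then show ?case by simp
    qed
  qed (use bnd in auto)
  then have "(\<lambda>n. \<integral>\<omega>. norm (iexp (t * A n \<omega>) - 1) \<partial>M) \<longlonglongrightarrow> 0"
    by simp
  moreover have bound: "norm (char (distr M borel (\<lambda>\<omega>. V n \<omega> + A n \<omega>)) t - char (distr M borel (V n)) t)
      \<le> (\<integral>\<omega>. norm (iexp (t * A n \<omega>) - 1) \<partial>M)" for n
  proof -
    have "char (distr M borel (\<lambda>\<omega>. V n \<omega> + A n \<omega>)) t - char (distr M borel (V n)) t
        = (\<integral>\<omega>. iexp (t * (V n \<omega> + A n \<omega>)) \<partial>M) - (\<integral>\<omega>. iexp (t * V n \<omega>) \<partial>M)"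
      unfolding char_def by (simp add: integral_distr)
    also have "\<dots> = (\<integral>\<omega>. iexp (t * (V n \<omega> + A n \<omega>)) - iexp (t * V n \<omega>) \<partial>M)"
      by (intro Bochner_Integration.integral_diff[symmetric] int) measurable
    also have "norm \<dots> \<le> (\<integral>\<omega>. norm (iexp (t * (V n \<omega> + A n \<omega>)) - iexp (t * V n \<omega>)) \<partial>M)"
      by (rule integral_norm_bound)
    also have "\<dots> = (\<integral>\<omega>. norm (iexp (t * A n \<omega>) - 1) \<partial>M)"
    proof (intro Bochner_Integration.integral_cong refl)
      fix \<omega>
      have "iexp (t * (V n \<omega> + A n \<omega>)) - iexp (t * V n \<omega>) = iexp (t * V n \<omega>) * (iexp (t * A n \<omega>) - 1)"
        by (simp add: exp_add ring_distribs)
      then show "norm (iexp (t * (V n \<omega> + A n \<omega>)) - iexp (t * V n \<omega>)) = norm (iexp (t * A n \<omega>) - 1)"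
        by (simp only: norm_mult norm_exp_i_times)
    qed
    finally show ?thesis .
  qed
  ultimately have "(\<lambda>n. char (distr M borel (\<lambda>\<omega>. V n \<omega> + A n \<omega>)) t - char (distr M borel (V n)) t) \<longlonglongrightarrow> 0"
    by (intro Lim_null_comparison[OF always_eventually[OF allI[OF bound]]])
  moreover have "(\<lambda>n. char (distr M borel (V n)) t) \<longlonglongrightarrow> char N t"
    using V N lim by (intro levy_continuity1) auto
  ultimately show "(\<lambda>n. char (distr M borel (\<lambda>\<omega>. V n \<omega> + A n \<omega>)) t) \<longlonglongrightarrow> char N t"
    using tendsto_add[of _ 0 sequentially _ "char N t"] by fastforce
qed (use N in auto)

text \<open>The comparison \<open>V \<le> A\<close> is the event that \<open>V + (a - A)\<close>, which has the same weak limit as \<open>V\<close>, is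
  at most \<open>a\<close>. The strict version needs the continuity-set form of weak convergence, because
  distribution functions only see closed half-lines.\<close>

lemma (in prob_space) prob_compare_std_normal_limit:
  fixes V A :: "nat \<Rightarrow> 'a \<Rightarrow> real"
  assumes V[measurable]: "\<And>n. V n \<in> borel_measurable M" and A[measurable]: "\<And>n. A n \<in> borel_measurable M"
    and lim: "weak_conv_m (\<lambda>n. distr M borel (V n)) std_normal_distribution"
    and A_lim: "AE \<omega> in M. (\<lambda>n. A n \<omega>) \<longlonglongrightarrow> a"
  shows "(\<lambda>n. prob {\<omega> \<in> space M. V n \<omega> \<le> A n \<omega>}) \<longlonglongrightarrow> cdf std_normal_distribution a" (is ?le)
    and "(\<lambda>n. prob {\<omega> \<in> space M. V n \<omega> < A n \<omega>}) \<longlonglongrightarrow> cdf std_normal_distribution a" (is ?lt)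
proof -
  interpret N: real_distribution std_normal_distribution by (rule real_dist_normal_dist)
  have null: "AE \<omega> in M. (\<lambda>n. a - A n \<omega>) \<longlonglongrightarrow> 0"
    using A_lim
  proof eventually_elim
    case (elim \<omega>)
    then show ?case using tendsto_diff[OF tendsto_const elim, of a] by simp
  qed
  have conv: "weak_conv_m (\<lambda>n. distr M borel (\<lambda>\<omega>. V n \<omega> + (a - A n \<omega>))) std_normal_distribution"
    by (rule weak_conv_add_null_sequence[OF _ _ real_dist_normal_dist lim null]) auto
  have null_a: "emeasure std_normal_distribution {a} = 0"
    using measure_std_normal_singleton[of a] by (simp add: N.emeasure_eq_measure)
  have set_lim: "(\<lambda>n. measure (distr M borel (\<lambda>\<omega>. V n \<omega> + (a - A n \<omega>))) S)
      \<longlonglongrightarrow> measure std_normal_distribution S" if "S \<in> sets borel" "frontier S = {a}" for S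
    using that null_a
    by (intro weak_conv_imp_continuity_set_conv[OF _ real_dist_normal_dist conv]) auto
  have "measure (distr M borel (\<lambda>\<omega>. V n \<omega> + (a - A n \<omega>))) {..a} = prob {\<omega> \<in> space M. V n \<omega> \<le> A n \<omega>}" for n
  proof -
    have "(\<lambda>\<omega>. V n \<omega> + (a - A n \<omega>)) -` {..a} \<inter> space M = {\<omega> \<in> space M. V n \<omega> \<le> A n \<omega>}"
      by auto
    moreover have "(\<lambda>\<omega>. V n \<omega> + (a - A n \<omega>)) \<in> borel_measurable M"
      by measurable
    ultimately show ?thesis
      by (simp only: measure_distr borel_open borel_closed open_lessThan closed_atMost)
  qed
  moreover have "(\<lambda>n. measure (distr M borel (\<lambda>\<omega>. V n \<omega> + (a - A n \<omega>))) {..a})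
      \<longlonglongrightarrow> measure std_normal_distribution {..a}"
    by (rule set_lim) simp_all
  ultimately show ?le
    by (simp only: cdf_def)
  have "measure (distr M borel (\<lambda>\<omega>. V n \<omega> + (a - A n \<omega>))) {..<a} = prob {\<omega> \<in> space M. V n \<omega> < A n \<omega>}" for n
  proof -
    have "(\<lambda>\<omega>. V n \<omega> + (a - A n \<omega>)) -` {..<a} \<inter> space M = {\<omega> \<in> space M. V n \<omega> < A n \<omega>}"
      by auto
    moreover have "(\<lambda>\<omega>. V n \<omega> + (a - A n \<omega>)) \<in> borel_measurable M"
      by measurable
    ultimately show ?thesis
      by (simp only: measure_distr borel_open borel_closed open_lessThan closed_atMost)
  qed
  moreover have "measure std_normal_distribution {..<a} = cdf std_normal_distribution a"
  proof -
    have "{..a} = {..<a} \<union> {a}" by auto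
    then have "cdf std_normal_distribution a = measure std_normal_distribution ({..<a} \<union> {a})"
      by (simp only: cdf_def)
    also have "\<dots> = measure std_normal_distribution {..<a}"
      by (subst N.finite_measure_Union) (auto simp: measure_std_normal_singleton)
    finally show ?thesis ..
  qed
  moreover have "(\<lambda>n. measure (distr M borel (\<lambda>\<omega>. V n \<omega> + (a - A n \<omega>))) {..<a})
      \<longlonglongrightarrow> measure std_normal_distribution {..<a}"
    by (rule set_lim) simp_all
  ultimately show ?lt
    by (simp only:)
qed

text \<open>The bounds need not be ordered for finite \<open>n\<close>. Inclusion and exclusion leaves the probability
  of \<open>B \<le> V \<le> A\<close> as a correction, and it vanishes because \<open>A < B\<close> holds eventually, almost surely.\<close>

lemma (in prob_space) prob_between_std_normal_limit:
  fixes V A B :: "nat \<Rightarrow> 'a \<Rightarrow> real"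
  assumes V[measurable]: "\<And>n. V n \<in> borel_measurable M"
    and A[measurable]: "\<And>n. A n \<in> borel_measurable M" and B[measurable]: "\<And>n. B n \<in> borel_measurable M"
    and lim: "weak_conv_m (\<lambda>n. distr M borel (V n)) std_normal_distribution"
    and A_lim: "AE \<omega> in M. (\<lambda>n. A n \<omega>) \<longlonglongrightarrow> a" and B_lim: "AE \<omega> in M. (\<lambda>n. B n \<omega>) \<longlonglongrightarrow> b"
    and "a < b"
  shows "(\<lambda>n. prob {\<omega> \<in> space M. A n \<omega> < V n \<omega> \<and> V n \<omega> < B n \<omega>})
    \<longlonglongrightarrow> cdf std_normal_distribution b - cdf std_normal_distribution a"
proof -
  let ?R = "\<lambda>n. {\<omega> \<in> space M. B n \<omega> \<le> V n \<omega> \<and> V n \<omega> \<le> A n \<omega>}"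
  let ?Q = "\<lambda>n. {\<omega> \<in> space M. B n \<omega> \<le> A n \<omega>}"
  have "(\<lambda>n. \<integral>\<omega>. indicator (?Q n) \<omega> \<partial>M) \<longlonglongrightarrow> (\<integral>\<omega>. (0::real) \<partial>M)"
  proof (rule integral_dominated_convergence[where w = "\<lambda>_. 1"])
    show "AE \<omega> in M. (\<lambda>n. indicator (?Q n) \<omega> :: real) \<longlonglongrightarrow> 0"
      using A_lim B_lim
    proof eventually_elim
      case (elim \<omega>)
      obtain m where m: "a < m" "m < b" using \<open>a < b\<close> dense by blast
      have "\<forall>\<^sub>F n in sequentially. (indicator (?Q n) \<omega> :: real) = 0"
        using order_tendstoD(2)[OF elim(1) m(1)] order_tendstoD(1)[OF elim(2) m(2)]
        by eventually_elim auto
      then show ?case by (rule tendsto_eventually)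
    qed
  qed (auto split: split_indicator)
  then have Q: "(\<lambda>n. prob (?Q n)) \<longlonglongrightarrow> 0"
    by simp
  have R: "(\<lambda>n. prob (?R n)) \<longlonglongrightarrow> 0"
  proof (rule Lim_null_comparison[OF _ Q], rule always_eventually, rule allI)
    show "norm (prob (?R n)) \<le> prob (?Q n)" for n
      by simp (intro finite_measure_mono, auto)
  qed
  have "prob {\<omega> \<in> space M. A n \<omega> < V n \<omega> \<and> V n \<omega> < B n \<omega>}
      = prob {\<omega> \<in> space M. V n \<omega> < B n \<omega>} - prob {\<omega> \<in> space M. V n \<omega> \<le> A n \<omega>} + prob (?R n)" for n
  proof -
    let ?C = "{\<omega> \<in> space M. V n \<omega> \<le> A n \<omega> \<and> V n \<omega> < B n \<omega>}"
    have "prob ({\<omega> \<in> space M. A n \<omega> < V n \<omega> \<and> V n \<omega> < B n \<omega>} \<union> ?C)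
        = prob {\<omega> \<in> space M. A n \<omega> < V n \<omega> \<and> V n \<omega> < B n \<omega>} + prob ?C"
      by (rule finite_measure_Union) auto
    moreover have "{\<omega> \<in> space M. A n \<omega> < V n \<omega> \<and> V n \<omega> < B n \<omega>} \<union> ?C = {\<omega> \<in> space M. V n \<omega> < B n \<omega>}"
      by auto
    moreover have "prob (?R n \<union> ?C) = prob (?R n) + prob ?C"
      by (rule finite_measure_Union) auto
    moreover have "?R n \<union> ?C = {\<omega> \<in> space M. V n \<omega> \<le> A n \<omega>}"
      by auto
    ultimately show ?thesis by simp
  qed
  moreover have "(\<lambda>n. prob {\<omega> \<in> space M. V n \<omega> < B n \<omega>} - prob {\<omega> \<in> space M. V n \<omega> \<le> A n \<omega>} + prob (?R n))
      \<longlonglongrightarrow> cdf std_normal_distribution b - cdf std_normal_distribution a + 0"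
    by (intro tendsto_intros R prob_compare_std_normal_limit V A B lim A_lim B_lim)
  ultimately show ?thesis by simp
qed

section \<open>Expansion and coverage for a random sample\<close>

text \<open>A quantile is at most \<open>t\<close> iff the Dirichlet probability of not exceeding \<open>t\<close> has reached the level, and
  this probability is the measure of a section of a measurable set in the product of the sample space
  and the simplex. This makes the coverage event measurable.\<close>

lemma quantile_dirichlet_measurable:
  fixes X :: "nat \<Rightarrow> 'a \<Rightarrow> real"
  assumes X: "\<And>i. i \<ge> 1 \<Longrightarrow> X i \<in> borel_measurable M" and q: "q \<in> {0<..<1}"
  shows "(\<lambda>\<omega>. quantile (dirichlet n (\<lambda>_. 1)) (\<lambda>D. b * D 0 + (\<Sum>i=1..n. X i \<omega> * D i)) q) \<in> borel_measurable M"
proof -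
  let ?N = "dirichlet n (\<lambda>_. 1)"
  interpret N: prob_space ?N by (rule prob_space_dirichlet_one)
  show ?thesis
    unfolding borel_measurable_iff_le
  proof
    fix t
    let ?Q = "{p \<in> space (M \<Otimes>\<^sub>M ?N). b * snd p 0 + (\<Sum>i=1..n. X i (fst p) * snd p i) \<le> t}"
    have [measurable]: "(\<lambda>p. snd p k) \<in> borel_measurable (M \<Otimes>\<^sub>M ?N)" if "k \<in> {0..n}" for k
      using that by measurable
    have [measurable]: "(\<lambda>p. X i (fst p)) \<in> borel_measurable (M \<Otimes>\<^sub>M ?N)" if "i \<in> {1..n}" for i
      using that X[of i] by (intro measurable_compose[OF measurable_fst]) auto
    have "(\<lambda>p. b * snd p 0 + (\<Sum>i=1..n. X i (fst p) * snd p i)) \<in> borel_measurable (M \<Otimes>\<^sub>M ?N)"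
      by (intro borel_measurable_add borel_measurable_sum borel_measurable_times) auto
    then have "?Q \<in> sets (M \<Otimes>\<^sub>M ?N)"
      by (rule borel_measurable_le[OF _ borel_measurable_const])
    then have [measurable]: "(\<lambda>\<omega>. emeasure ?N (Pair \<omega> -` ?Q)) \<in> borel_measurable M"
      by (rule N.measurable_emeasure_Pair)
    have "quantile ?N (\<lambda>D. b * D 0 + (\<Sum>i=1..n. X i \<omega> * D i)) q \<le> t \<longleftrightarrow> ennreal q \<le> emeasure ?N (Pair \<omega> -` ?Q)"
      if "\<omega> \<in> space M" for \<omega>
    proof -
      have "Pair \<omega> -` ?Q = {D \<in> space ?N. b * D 0 + (\<Sum>i=1..n. X i \<omega> * D i) \<le> t}"
        using that by (auto simp: space_pair_measure)
      moreover have "ennreal q \<le> ennreal p \<longleftrightarrow> q \<le> p" for p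
        using q by (intro ennreal_le_iff2[THEN trans]) auto
      ultimately show ?thesis
        using quantile_le_iff[OF prob_space_dirichlet_one gaffke_endpoint_measurable q]
        by (simp add: N.emeasure_eq_measure)
    qed
    then have "{\<omega> \<in> space M. quantile ?N (\<lambda>D. b * D 0 + (\<Sum>i=1..n. X i \<omega> * D i)) q \<le> t}
        = {\<omega> \<in> space M. ennreal q \<le> emeasure ?N (Pair \<omega> -` ?Q)}"
      by auto
    also have "\<dots> \<in> sets M"
      by measurable
    finally show "{\<omega> \<in> space M. quantile ?N (\<lambda>D. b * D 0 + (\<Sum>i=1..n. X i \<omega> * D i)) q \<le> t} \<in> sets M" .
  qed
qed

lemma (in prob_space) indep_vars_reindex:
  assumes "inj_on f I" and "indep_vars N X (f ` I)"
  shows "indep_vars (\<lambda>i. N (f i)) (\<lambda>i. X (f i)) I"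
proof -
  let ?F = "\<lambda>i. {X i -` A \<inter> space M | A. A \<in> sets (N i)}"
  have F: "indep_sets ?F (f ` I)" and rv: "\<And>i. i \<in> I \<Longrightarrow> random_variable (N (f i)) (X (f i))"
    using assms(2) unfolding indep_vars_def2 by auto
  have "indep_sets (\<lambda>i. ?F (f i)) I"
  proof (rule indep_setsI)
    show "?F (f i) \<subseteq> events" if "i \<in> I" for i
      using rv[OF that] by (auto intro: measurable_sets)
    fix A J assume J: "J \<noteq> {}" "J \<subseteq> I" "finite J" and A: "\<forall>j\<in>J. A j \<in> ?F (f j)"
    let ?g = "inv_into I f"
    have g: "?g (f j) = j" if "j \<in> J" for j
      using assms(1) J(2) that by (auto intro: inv_into_f_f)
    have inj: "inj_on f J"
      using assms(1) J(2) by (rule inj_on_subset)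
    have "prob (\<Inter>k\<in>f ` J. A (?g k)) = (\<Prod>k\<in>f ` J. prob (A (?g k)))"
    proof (rule indep_setsD[OF F])
      show "\<forall>k\<in>f ` J. A (?g k) \<in> ?F k"
        using A g by (simp add: ball_simps)
    qed (use J in auto)
    moreover have "(\<Inter>k\<in>f ` J. A (?g k)) = (\<Inter>j\<in>J. A j)"
      using g by simp
    moreover have "(\<Prod>k\<in>f ` J. prob (A (?g k))) = (\<Prod>j\<in>J. prob (A j))"
      using g by (simp add: prod.reindex[OF inj])
    ultimately show "prob (\<Inter>j\<in>J. A j) = (\<Prod>j\<in>J. prob (A j))"
      by simp
  qed
  then show ?thesis
    unfolding indep_vars_def2 using rv by auto
qed

theorem theorem6p2:
  fixes M :: "'a measure"
    and X :: "nat \<Rightarrow> 'a \<Rightarrow> real"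
    and \<mu> \<sigma> \<alpha>L \<alpha>U :: real
  assumes "prob_space M"
    and "prob_space.indep_vars M (\<lambda>_. borel) X {1..}"
    and "\<And>i. i \<ge> 1 \<Longrightarrow> distr M borel (X i) = distr M borel (X 1)"
    and "\<And>i \<omega>. i \<ge> 1 \<Longrightarrow> \<omega> \<in> space M \<Longrightarrow> X i \<omega> \<in> {0..1}"
    and "prob_space.expectation M (X 1) = \<mu>"
    and "prob_space.variance M (X 1) = \<sigma>\<^sup>2"
    and "\<sigma> > 0"
    and "\<alpha>L \<in> {0<..<1}" and "\<alpha>U \<in> {0<..<1}"
  shows "(AE \<omega> in M.
            (\<lambda>n. gaffke_lower n \<alpha>L (\<lambda>i. X i \<omega>)
                  - (sample_mean n (\<lambda>i. X i \<omega>)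
                     + sample_sd n (\<lambda>i. X i \<omega>) / sqrt (real n) * std_normal_quantile \<alpha>L))
              \<in> o(\<lambda>n. real n powr (- 1 / 2))
          \<and> (\<lambda>n. gaffke_upper n \<alpha>U (\<lambda>i. X i \<omega>)
                  - (sample_mean n (\<lambda>i. X i \<omega>)
                     + sample_sd n (\<lambda>i. X i \<omega>) / sqrt (real n) * std_normal_quantile (1 - \<alpha>U)))
              \<in> o(\<lambda>n. real n powr (- 1 / 2)))
       \<and> (AE \<omega> in M.
            (\<lambda>n. sqrt (real n) * (gaffke_upper n \<alpha>U (\<lambda>i. X i \<omega>) - gaffke_lower n \<alpha>L (\<lambda>i. X i \<omega>)))
              \<longlonglongrightarrow> \<sigma> * (std_normal_quantile (1 - \<alpha>U) - std_normal_quantile \<alpha>L))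
       \<and> (\<alpha>L + \<alpha>U < 1 \<longrightarrow>
            (\<lambda>n. measure M {\<omega> \<in> space M. gaffke_lower n \<alpha>L (\<lambda>i. X i \<omega>) < \<mu>
                                       \<and> \<mu> < gaffke_upper n \<alpha>U (\<lambda>i. X i \<omega>)})
              \<longlonglongrightarrow> 1 - \<alpha>L - \<alpha>U)"
proof -
  interpret prob_space M by fact
  note indep = assms(2) and distr = assms(3) and range = assms(4) and mean = assms(5)
    and var = assms(6) and \<sigma> = assms(7) and \<alpha>L = assms(8) and \<alpha>U = assms(9)
  have rv: "X i \<in> borel_measurable M" if "i \<ge> 1" for i
    using indep that by (auto simp: indep_vars_def)
  let ?x = "\<lambda>\<omega> i. X i \<omega>"
  let ?L = "\<lambda>n \<omega>. gaffke_lower n \<alpha>L (?x \<omega>)" and ?U = "\<lambda>n \<omega>. gaffke_upper n \<alpha>U (?x \<omega>)"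
  let ?m = "\<lambda>n \<omega>. sample_mean n (?x \<omega>)"
  let ?zL = "std_normal_quantile \<alpha>L" and ?zU = "std_normal_quantile (1 - \<alpha>U)"
  have sd: "AE \<omega> in M. (\<lambda>n. sample_sd n (?x \<omega>)) \<longlonglongrightarrow> \<sigma>"
    using indep distr range var \<sigma> by (rule sample_sd_consistent)
  have L: "AE \<omega> in M. (\<lambda>n. sqrt (real n) * (?L n \<omega> - ?m n \<omega>)) \<longlonglongrightarrow> \<sigma> * ?zL"
    using sd AE_space
    by eventually_elim (rule gaffke_lower_limit[OF range _ \<sigma> \<alpha>L])
  have U: "AE \<omega> in M. (\<lambda>n. sqrt (real n) * (?U n \<omega> - ?m n \<omega>)) \<longlonglongrightarrow> \<sigma> * ?zU"
    using sd AE_space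
    by eventually_elim (rule gaffke_upper_limit[OF range _ \<sigma> \<alpha>U])

  have expansion: "AE \<omega> in M.
      (\<lambda>n. ?L n \<omega> - (?m n \<omega> + sample_sd n (?x \<omega>) / sqrt (real n) * ?zL)) \<in> o(\<lambda>n. real n powr (- 1 / 2))
    \<and> (\<lambda>n. ?U n \<omega> - (?m n \<omega> + sample_sd n (?x \<omega>) / sqrt (real n) * ?zU)) \<in> o(\<lambda>n. real n powr (- 1 / 2))"
    using L U sd by eventually_elim (intro conjI smallo_inverse_sqrt)

  have "AE \<omega> in M. (\<lambda>n. sqrt (real n) * (?U n \<omega> - ?L n \<omega>)) \<longlonglongrightarrow> \<sigma> * ?zU - \<sigma> * ?zL"
    using L U
  proof eventually_elim
    case (elim \<omega>)
    show ?case
      using tendsto_diff[OF elim(2,1)] by (simp add: algebra_simps)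
  qed
  then have width: "AE \<omega> in M. (\<lambda>n. sqrt (real n) * (?U n \<omega> - ?L n \<omega>)) \<longlonglongrightarrow> \<sigma> * (?zU - ?zL)"
    by (simp only: right_diff_distrib)

  have coverage: "(\<lambda>n. prob {\<omega> \<in> space M. ?L n \<omega> < \<mu> \<and> \<mu> < ?U n \<omega>}) \<longlonglongrightarrow> 1 - \<alpha>L - \<alpha>U"
    if "\<alpha>L + \<alpha>U < 1"
  proof -
    define V where "V n \<omega> = sqrt (real n) * (\<mu> - ?m n \<omega>) / \<sigma>" for n \<omega>
    define A where "A n \<omega> = sqrt (real n) * (?L n \<omega> - ?m n \<omega>) / \<sigma>" for n \<omega>
    define B where "B n \<omega> = sqrt (real n) * (?U n \<omega> - ?m n \<omega>) / \<sigma>" for n \<omega>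
    have m_meas [measurable]: "?m n \<in> borel_measurable M" for n
      unfolding sample_mean_def using rv by (intro borel_measurable_divide borel_measurable_sum) auto
    have L_meas [measurable]: "?L n \<in> borel_measurable M" for n
      using quantile_dirichlet_measurable[where X = X and n = n and b = 0, OF rv \<alpha>L] by (simp add: gaffke_lower_def)
    have U_meas [measurable]: "?U n \<in> borel_measurable M" for n
      using quantile_dirichlet_measurable[where X = X and n = n and b = 1 and q = "1 - \<alpha>U", OF rv] \<alpha>U by (simp add: gaffke_upper_def)
    have meas [measurable]: "V n \<in> borel_measurable M" "A n \<in> borel_measurable M" "B n \<in> borel_measurable M" for n
      unfolding V_def A_def B_def by measurable
    have A_lim: "AE \<omega> in M. (\<lambda>n. A n \<omega>) \<longlonglongrightarrow> ?zL"
      using L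
    proof eventually_elim
      case (elim \<omega>)
      show ?case
        using tendsto_divide[OF elim tendsto_const, of \<sigma>] \<sigma> by (simp add: A_def)
    qed
    have B_lim: "AE \<omega> in M. (\<lambda>n. B n \<omega>) \<longlonglongrightarrow> ?zU"
      using U
    proof eventually_elim
      case (elim \<omega>)
      show ?case
        using tendsto_divide[OF elim tendsto_const, of \<sigma>] \<sigma> by (simp add: B_def)
    qed
    have cdf_L: "cdf std_normal_distribution ?zL = \<alpha>L" and cdf_U: "cdf std_normal_distribution ?zU = 1 - \<alpha>U"
      using \<alpha>L \<alpha>U by (auto intro!: cdf_std_normal_quantile)
    have "?zL < ?zU"
      using strict_mono_less[OF strict_mono_cdf_std_normal, of ?zL ?zU] that unfolding cdf_L cdf_U by simp

    \<comment> \<open>The theorem is applied to \<open>\<mu> - X\<close> instead of \<open>X - \<mu>\<close>: then \<open>V\<close> is compared with the rescaled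
      endpoints directly, without a reflection of the normal law.\<close>
    have V_lim: "weak_conv_m (\<lambda>n. distr M borel (V n)) std_normal_distribution"
    proof -
      let ?Y = "\<lambda>i \<omega>. \<mu> - X (Suc i) \<omega>"
      have int: "integrable M (X i)" if "i \<ge> 1" for i
        using rv[OF that] range[OF that] by (intro integrable_const_bound[of _ 1]) auto
      have exp_eq: "expectation (\<lambda>\<omega>. g (X i \<omega>)) = expectation (\<lambda>\<omega>. g (X 1 \<omega>))"
        if "i \<ge> 1" "g \<in> borel_measurable borel" for i and g :: "real \<Rightarrow> real"
        using integral_distr[OF rv[OF that(1)] that(2)] integral_distr[OF rv[of 1] that(2)] distr[OF that(1)] by simp
      have "weak_conv_m (\<lambda>n. distr M borel (\<lambda>\<omega>. (\<Sum>i<n. ?Y i \<omega>) / sqrt (n * \<sigma>\<^sup>2))) std_normal_distribution"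
      proof (rule central_limit_theorem_zero_mean)
        have "indep_vars (\<lambda>_. borel) X (range Suc)"
          using indep by (rule indep_vars_subset) auto
        then have "indep_vars (\<lambda>_. borel) (\<lambda>i. X (Suc i)) UNIV"
          by (rule indep_vars_reindex[OF inj_Suc])
        then show "indep_vars (\<lambda>_. borel) ?Y UNIV"
          by (rule indep_vars_compose2) auto
        fix i
        show mean_0: "expectation (?Y i) = 0"
          using int[of "Suc i"] exp_eq[of "Suc i" "\<lambda>z. z"] mean by (simp add: prob_space)
        show "integrable M (\<lambda>\<omega>. (?Y i \<omega>)\<^sup>2)"
        proof (rule integrable_const_bound[of _ "(\<bar>\<mu>\<bar> + 1)\<^sup>2"])
          show "AE \<omega> in M. norm ((?Y i \<omega>)\<^sup>2) \<le> (\<bar>\<mu>\<bar> + 1)\<^sup>2"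
          proof (rule AE_I2)
            fix \<omega> assume "\<omega> \<in> space M"
            then have "X (Suc i) \<omega> \<in> {0..1}"
              by (intro range) simp_all
            then have "\<bar>?Y i \<omega>\<bar> \<le> \<bar>\<bar>\<mu>\<bar> + 1\<bar>"
              unfolding atLeastAtMost_iff by linarith
            then show "norm ((?Y i \<omega>)\<^sup>2) \<le> (\<bar>\<mu>\<bar> + 1)\<^sup>2"
              unfolding abs_le_square_iff by simp
          qed
        qed (use rv[of "Suc i"] in auto)
        have "variance (?Y i) = expectation (\<lambda>\<omega>. (\<mu> - X (Suc i) \<omega>)\<^sup>2)"
          using mean_0 by simp
        also have "\<dots> = expectation (\<lambda>\<omega>. (\<mu> - X 1 \<omega>)\<^sup>2)"
          by (rule exp_eq) auto
        also have "\<dots> = \<sigma>\<^sup>2"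
          using var mean by (simp add: power2_commute)
        finally show "variance (?Y i) = \<sigma>\<^sup>2" .
        have "distr M borel (?Y i) = distr (distr M borel (X (Suc i))) borel (\<lambda>z. \<mu> - z)"
          using rv[of "Suc i"] by (subst distr_distr) (auto simp: comp_def)
        then show "distr M borel (?Y i) = distr (distr M borel (X 1)) borel (\<lambda>z. \<mu> - z)"
          using distr[of "Suc i"] by simp
      qed (rule \<sigma>)
      moreover have "(\<Sum>i<n. ?Y i \<omega>) / sqrt (n * \<sigma>\<^sup>2) = V n \<omega>" for n \<omega>
      proof -
        have "(\<Sum>i<n. X (Suc i) \<omega>) = (\<Sum>i=1..n. X i \<omega>)"
          by (rule sum.reindex_bij_witness[of _ "\<lambda>i. i - 1" Suc]) auto
        also have "\<dots> = n * ?m n \<omega>"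
          by (cases "n = 0") (auto simp: sample_mean_def)
        finally have "(\<Sum>i<n. ?Y i \<omega>) = sqrt n * (sqrt n * (\<mu> - ?m n \<omega>))"
          by (simp add: sum_subtractf right_diff_distrib mult.assoc[symmetric])
        then show ?thesis
          using \<sigma> by (cases "n = 0") (auto simp: V_def real_sqrt_mult)
      qed
      ultimately show ?thesis by simp
    qed
    have "(\<lambda>n. prob {\<omega> \<in> space M. A n \<omega> < V n \<omega> \<and> V n \<omega> < B n \<omega>}) \<longlonglongrightarrow> (1 - \<alpha>U) - \<alpha>L"
      using prob_between_std_normal_limit[OF meas(1) meas(2) meas(3) V_lim A_lim B_lim \<open>?zL < ?zU\<close>]
      unfolding cdf_L cdf_U .
    moreover have "{\<omega> \<in> space M. A n \<omega> < V n \<omega> \<and> V n \<omega> < B n \<omega>} = {\<omega> \<in> space M. ?L n \<omega> < \<mu> \<and> \<mu> < ?U n \<omega>}"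
      if "n \<ge> 1" for n
      using that \<sigma> by (auto simp: A_def B_def V_def divide_less_cancel)
    then have "\<forall>\<^sub>F n in sequentially. prob {\<omega> \<in> space M. A n \<omega> < V n \<omega> \<and> V n \<omega> < B n \<omega>}
        = prob {\<omega> \<in> space M. ?L n \<omega> < \<mu> \<and> \<mu> < ?U n \<omega>}"
      by (intro eventually_mono[OF eventually_ge_at_top[of 1]]) simp
    ultimately show ?thesis
      by (auto dest: Lim_transform_eventually simp: algebra_simps)
  qed
  show ?thesis
    using expansion width coverage by blast
qed

end
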